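(* Fix $c\in(0,1)$ and assume $r=r(n)\leq cn^{-1/4}$. Let $G\sim RG(n,r)$. If $n=m^2t^2$ for positive integers $m,t$ with $(\ln n)^4\leq t\leq \frac{r\,n^{1/2}}{\ln n}$, then asymptotically almost surely $G$ has an optimal orthogonal colouring, i.e. $O\chi(G)=\lceil\sqrt{n}\,\rceil$.
   Context: Random geometric graph: $RG(n,r)$ is the random graph obtained by placing $n$ points independently and uniformly at random in the unit square $[0,1]^2$; these points are the vertices, and two distinct vertices are adjacent if and only if their Euclidean distance is less than $r$. $G\sim RG(n,r)$ means $G$ is sampled from this model. Orthogonal colouring: two proper vertex colourings $c_1,c_2$ of a graph $G$ are orthogonal if any two distinct vertices that receive the same colour in one colouring receive distinct colours in the other (equivalently, $v\mapsto (c_1(v),c_2(v))$ is injective). An orthogonal colouring is a pair of orthogonal proper colourings. The orthogonal chromatic number $O\chi(G)$ is the minimum $k$ such that $G$ has an orthogonal colouring in which both colourings use colours from a common set of $k$ colours. A graph $G$ on $n$ vertices always satisfies $O\chi(G)\geq\lceil\sqrt n\,\rceil$; $G$ has an optimal orthogonal colouring if $O\chi(G)=\lceil\sqrt n\,\rceil$. Here $m=m(n)$ and $t=t(n)$ depend on $n$, and $n$ ranges over those values admitting such a factorization. Asymptotically almost surely means with probability tending to $1$ as $n\to\infty$ along these values. *)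

theory Defs
  imports "HOL-Probability.Probability"
begin

text \<open>A graph is given by its vertex set and its adjacency relation.\<close>

definition proper_colouring :: "'v set \<Rightarrow> ('v \<Rightarrow> 'v \<Rightarrow> bool) \<Rightarrow> ('v \<Rightarrow> 'c) \<Rightarrow> bool" where
  "proper_colouring V adj c \<longleftrightarrow> (\<forall>u\<in>V. \<forall>v\<in>V. adj u v \<longrightarrow> c u \<noteq> c v)"

definition orthogonal_colourings :: "'v set \<Rightarrow> ('v \<Rightarrow> 'c) \<Rightarrow> ('v \<Rightarrow> 'c) \<Rightarrow> bool" where
  "orthogonal_colourings V c1 c2 \<longleftrightarrow>
     (\<forall>u\<in>V. \<forall>v\<in>V. u \<noteq> v \<longrightarrow>
        (c1 u = c1 v \<longrightarrow> c2 u \<noteq> c2 v) \<and> (c2 u = c2 v \<longrightarrow> c1 u \<noteq> c1 v))"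

definition orthogonally_colourable :: "'v set \<Rightarrow> ('v \<Rightarrow> 'v \<Rightarrow> bool) \<Rightarrow> nat \<Rightarrow> bool" where
  "orthogonally_colourable V adj k \<longleftrightarrow>
     (\<exists>c1 c2. c1 \<in> V \<rightarrow> {..<k} \<and> c2 \<in> V \<rightarrow> {..<k} \<and>
        proper_colouring V adj c1 \<and> proper_colouring V adj c2 \<and>
        orthogonal_colourings V c1 c2)"

text \<open>For a finite loopless graph the minimum exists: an injective colouring, used twice,
  shows that \<open>card V\<close> colours suffice.\<close>

definition orthogonal_chromatic_number :: "'v set \<Rightarrow> ('v \<Rightarrow> 'v \<Rightarrow> bool) \<Rightarrow> nat" where
  "orthogonal_chromatic_number V adj = (LEAST k. orthogonally_colourable V adj k)"

definition has_optimal_orthogonal_colouring :: "'v set \<Rightarrow> ('v \<Rightarrow> 'v \<Rightarrow> bool) \<Rightarrow> bool" where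
  "has_optimal_orthogonal_colouring V adj \<longleftrightarrow>
     orthogonal_chromatic_number V adj = nat \<lceil>sqrt (real (card V))\<rceil>"

text \<open>The vertices of the random geometric graph are the indices \<open>i < n\<close> of the sample points,
  so that there are always exactly \<open>n\<close> of them (coinciding sample points, an event of
  probability \<open>0\<close>, still count as distinct vertices). The distance on \<open>real \<times> real\<close> is
  Euclidean.\<close>

definition unit_square :: "(real \<times> real) set" where
  "unit_square = {0..1} \<times> {0..1}"

definition uniform_points :: "nat \<Rightarrow> (nat \<Rightarrow> real \<times> real) measure" where
  "uniform_points n = (\<Pi>\<^sub>M i\<in>{..<n}. uniform_measure lborel unit_square)"

definition geometric_adj :: "real \<Rightarrow> (nat \<Rightarrow> real \<times> real) \<Rightarrow> nat \<Rightarrow> nat \<Rightarrow> bool" where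
  "geometric_adj r x i j \<longleftrightarrow> i \<noteq> j \<and> dist (x i) (x j) < r"

text \<open>The probability that a sample of \<open>RG(n, r)\<close> has the graph property \<open>P\<close>.\<close>

definition RG_prob :: "nat \<Rightarrow> real \<Rightarrow> (nat set \<Rightarrow> (nat \<Rightarrow> nat \<Rightarrow> bool) \<Rightarrow> bool) \<Rightarrow> real" where
  "RG_prob n r P =
     measure (uniform_points n) {x \<in> space (uniform_points n). P {..<n} (geometric_adj r x)}"

text \<open>The values of \<open>n\<close> along which the limit is taken.\<close>

definition admissible_sizes :: "(nat \<Rightarrow> real) \<Rightarrow> (nat \<Rightarrow> nat) \<Rightarrow> (nat \<Rightarrow> nat) \<Rightarrow> nat set" where
  "admissible_sizes r m t =
     {n. m n > 0 \<and> t n > 0 \<and> n = (m n)\<^sup>2 * (t n)\<^sup>2 \<and>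
         (ln (real n)) ^ 4 \<le> real (t n) \<and>
         real (t n) \<le> r n * real n powr (1 / 2) / ln (real n)}"

end

theory Submission
  imports Defs "HOL-Real_Asymp.Real_Asymp"
begin

text \<open>
  An admissible \<open>n\<close> is a square \<open>N\<^sup>2\<close> with \<open>N = m t\<close>. A pair of orthogonal colourings with \<open>k\<close>
  colours injects the vertices into \<open>k\<^sup>2\<close> pairs, so \<open>N\<close> colours are necessary, and what has to be
  found is an orthogonal colouring with exactly \<open>N\<close> colours.

  If the points formed the grid of all \<open>(a / N, b / N)\<close>, the linear colourings
  \<open>a - q b\<close> and \<open>a - (q + 1) b\<close> modulo \<open>N\<close>, with \<open>q = \<lfloor>sqrt N\<rfloor>\<close>, would do. Their difference is
  \<open>b\<close>, so the two colours determine the grid point. A colour class lies in a translate of the lattice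
  \<open>x \<equiv> k y\<close> modulo \<open>N\<close> with \<open>k \<in> {q, q + 1}\<close>, in which two distinct points differ by at least
  \<open>q - 1\<close> in some coordinate (\<open>sparse_residue_lattice\<close>). In the unit square this is a distance of
  nearly \<open>1 / sqrt N = n powr (- 1 / 4)\<close>, whereas \<open>r\<close> is at most \<open>c < 1\<close> times that number.

  A random sample is close enough to the grid. The points can be assigned to distinct grid points
  so that every coordinate moves by \<open>O(N powr (- 3 / 5))\<close>, which is negligible against
  \<open>(1 - c) / sqrt N\<close> (\<open>place_on_grid\<close>): sort the points by their first coordinate, cut the sorted
  sequence into strips that are to fill about \<open>N powr (2 / 5)\<close> grid columns each, and sort
  every strip by the second coordinate. Ranks follow coordinates as soon as all axis-parallel boxes
  standing on the bottom side contain about the expected number of points. Only boxes as narrow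
  as a strip need a precise count, and for these a Chernoff bound whose exponent benefits from the
  small variance, with a union bound over polynomially many boxes, suffices
  (\<open>evenly_spread_whp\<close>).
\<close>

section \<open>Orthogonal colourings of a square grid\<close>

text \<open>
  If both coordinates were smaller than \<open>q - 1\<close>, then \<open>x - k y\<close> would be smaller in absolute value
  than \<open>q\<^sup>2 \<le> N\<close>, so the congruence would be an equation \<open>x = k y\<close>. Since \<open>x\<close> is smaller than \<open>k\<close>,
  that forces \<open>x = y = 0\<close>.
\<close>

lemma sparse_residue_lattice:
  fixes N q k x y :: int
  assumes "0 \<le> q" "q\<^sup>2 \<le> N" "k = q \<or> k = q + 1" "N dvd x - k * y" "(x, y) \<noteq> (0, 0)"
  shows "q - 1 \<le> \<bar>x\<bar> \<or> q - 1 \<le> \<bar>y\<bar>"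
proof (rule ccontr)
  assume "\<not> ?thesis"
  then have x: "\<bar>x\<bar> \<le> q - 2" and y: "\<bar>y\<bar> \<le> q - 2"
    by auto
  have k: "0 \<le> k" "k \<le> q + 1" "q \<le> k" "2 \<le> q"
    using assms(1,3) x by auto
  have "\<bar>x - k * y\<bar> \<le> \<bar>x\<bar> + k * \<bar>y\<bar>"
    using k by (metis abs_mult abs_of_nonneg abs_triangle_ineq4)
  also have "\<dots> \<le> (q - 2) + (q + 1) * (q - 2)"
    using k x y by (intro add_mono mult_mono) auto
  also have "\<dots> < q\<^sup>2"
    using k by (simp add: power2_eq_square algebra_simps)
  finally have "\<bar>x - k * y\<bar> < N"
    using assms(2) by simp
  with assms(4) have eq: "x = k * y"
    using dvd_imp_le_int[of "x - k * y" N] by fastforce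
  have "y = 0"
  proof (rule ccontr)
    assume "y \<noteq> 0"
    then have "k * 1 \<le> k * \<bar>y\<bar>"
      using k by (intro mult_left_mono) auto
    also have "\<dots> = \<bar>x\<bar>"
      using eq k by (simp add: abs_mult)
    finally show False
      using x k by linarith
  qed
  with eq assms(5) show False
    by simp
qed

text \<open>
  The slopes \<open>q\<close> and \<open>q + 1\<close> both give sparse colour classes, and the determinant of the two linear
  forms \<open>a - q b\<close> and \<open>a - (q + 1) b\<close> is \<open>-1\<close>, so together they are injective modulo every \<open>N\<close>.
  The map \<open>g\<close> places the vertices on the grid. Adjacency is only asked to imply closeness there,
  which leaves room for an inexact placement.
\<close>

lemma orthogonally_colourable_from_grid:
  fixes N q :: nat and g :: "'v \<Rightarrow> nat \<times> nat"
  assumes N: "0 < N" and q: "q\<^sup>2 \<le> N"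
    and inj: "inj_on g V" and grid: "g ` V \<subseteq> {..<N} \<times> {..<N}"
    and loopless: "\<And>u. \<not> adj u u"
    and close: "\<And>u v. u \<in> V \<Longrightarrow> v \<in> V \<Longrightarrow> adj u v \<Longrightarrow>
      \<bar>int (fst (g u)) - int (fst (g v))\<bar> < int q - 1 \<and> \<bar>int (snd (g u)) - int (snd (g v))\<bar> < int q - 1"
  shows "orthogonally_colourable V adj N"
proof -
  define C where "C k v = nat ((int (fst (g v)) - k * int (snd (g v))) mod int N)" for k v
  have dvd: "int N dvd (int (fst (g u)) - int (fst (g v))) - k * (int (snd (g u)) - int (snd (g v)))"
    if "C k u = C k v" for k u v
  proof -
    have "(int (fst (g u)) - k * int (snd (g u))) mod int N
        = (int (fst (g v)) - k * int (snd (g v))) mod int N"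
      using that N by (simp add: C_def eq_nat_nat_iff)
    then show ?thesis by (simp add: mod_eq_dvd_iff algebra_simps)
  qed
  have range: "C k \<in> V \<rightarrow> {..<N}" for k
    using N by (auto simp: C_def nat_less_iff)
  have proper: "proper_colouring V adj (C k)" if k: "k = int q \<or> k = int q + 1" for k
    unfolding proper_colouring_def
  proof (intro ballI impI notI)
    fix u v assume uv: "u \<in> V" "v \<in> V" "adj u v" "C k u = C k v"
    then have "g u \<noteq> g v"
      using loopless inj by (metis inj_onD)
    then have "(int (fst (g u)) - int (fst (g v)), int (snd (g u)) - int (snd (g v))) \<noteq> (0, 0)"
      by (auto simp: prod_eq_iff)
    moreover have "(int q)\<^sup>2 \<le> int N"
      using q by (metis of_nat_le_iff of_nat_power)
    ultimately have "int q - 1 \<le> \<bar>int (fst (g u)) - int (fst (g v))\<bar>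
        \<or> int q - 1 \<le> \<bar>int (snd (g u)) - int (snd (g v))\<bar>"
      by (intro sparse_residue_lattice[OF _ _ k dvd[OF uv(4)]]) simp_all
    with close[OF uv(1-3)] show False by linarith
  qed
  have "orthogonal_colourings V (C (int q)) (C (int q + 1))"
  proof -
    have "u = v" if uv: "u \<in> V" "v \<in> V" "C (int q) u = C (int q) v" "C (int q + 1) u = C (int q + 1) v" for u v
    proof -
      let ?x = "int (fst (g u)) - int (fst (g v))" and ?y = "int (snd (g u)) - int (snd (g v))"
      have "g u \<in> {..<N} \<times> {..<N}" "g v \<in> {..<N} \<times> {..<N}"
        using grid uv(1,2) by blast+
      then have small: "\<bar>?x\<bar> < int N" "\<bar>?y\<bar> < int N"
        by (simp_all add: mem_Times_iff abs_less_iff)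
      have "int N dvd (?x - int q * ?y) - (?x - (int q + 1) * ?y)"
        by (intro dvd_diff dvd uv)
      then have "int N dvd ?y" by (simp add: algebra_simps)
      with small(2) have y: "?y = 0" using dvd_imp_le_int[of ?y "int N"] by linarith
      have "int N dvd ?x" using dvd[OF uv(3)] y by simp
      with small(1) have "?x = 0" using dvd_imp_le_int[of ?x "int N"] by linarith
      with y have "g u = g v" by (simp add: prod_eq_iff)
      then show ?thesis using inj uv(1,2) by (simp add: inj_on_def)
    qed
    then show ?thesis unfolding orthogonal_colourings_def by blast
  qed
  then show ?thesis
    unfolding orthogonally_colourable_def using range proper by blast
qed

lemma card_le_square_if_orthogonally_colourable:
  assumes "orthogonally_colourable V adj k" "finite V"
  shows "card V \<le> k\<^sup>2"
proof -
  obtain c1 c2 where c: "c1 \<in> V \<rightarrow> {..<k}" "c2 \<in> V \<rightarrow> {..<k}" "orthogonal_colourings V c1 c2"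
    using assms unfolding orthogonally_colourable_def by blast
  have "inj_on (\<lambda>v. (c1 v, c2 v)) V"
    using c(3) unfolding orthogonal_colourings_def inj_on_def by auto
  moreover have "(\<lambda>v. (c1 v, c2 v)) ` V \<subseteq> {..<k} \<times> {..<k}"
    using c(1,2) by auto
  ultimately have "card V \<le> card ({..<k} \<times> {..<k})"
    by (intro card_inj_on_le) auto
  then show ?thesis by (simp add: power2_eq_square)
qed

lemma has_optimal_orthogonal_colouring_square:
  assumes "orthogonally_colourable V adj N" "finite V" "card V = N\<^sup>2"
  shows "has_optimal_orthogonal_colouring V adj"
proof -
  have "orthogonal_chromatic_number V adj = N"
    unfolding orthogonal_chromatic_number_def
  proof (rule Least_equality)
    fix k assume "orthogonally_colourable V adj k"
    from card_le_square_if_orthogonally_colourable[OF this assms(2)] show "N \<le> k"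
      using assms(3) by (simp add: power2_nat_le_eq_le)
  qed (fact assms(1))
  then show ?thesis
    using assms(3) by (simp add: has_optimal_orthogonal_colouring_def)
qed

section \<open>Matching evenly spread points to the grid\<close>

text \<open>
  Ties are broken arbitrarily, since distinct vertices may share a coordinate.
\<close>

lemma ex_monotone_ranking:
  fixes f :: "'a \<Rightarrow> real"
  assumes "finite V"
  obtains \<rho> :: "'a \<Rightarrow> nat" where "bij_betw \<rho> V {..<card V}"
    "\<And>u v. u \<in> V \<Longrightarrow> v \<in> V \<Longrightarrow> \<rho> u < \<rho> v \<Longrightarrow> f u \<le> f v"
proof -
  have "\<exists>\<rho>. bij_betw \<rho> V {..<card V} \<and> (\<forall>u\<in>V. \<forall>v\<in>V. \<rho> u < \<rho> v \<longrightarrow> f u \<le> f v)"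
    using assms
  proof (induction "card V" arbitrary: V)
    case 0
    then show ?case by (auto simp: bij_betw_def)
  next
    case (Suc k)
    then have "V \<noteq> {}" by auto
    then have "Max (f ` V) \<in> f ` V"
      using Suc.prems by (intro Max_in) auto
    then obtain w where w: "w \<in> V" "f w = Max (f ` V)"
      by auto
    then have max: "f v \<le> f w" if "v \<in> V" for v
      using that Suc.prems by simp
    have card: "card (V - {w}) = k"
      using w Suc by simp
    then obtain \<rho> where \<rho>: "bij_betw \<rho> (V - {w}) {..<k}"
        "\<forall>u\<in>V - {w}. \<forall>v\<in>V - {w}. \<rho> u < \<rho> v \<longrightarrow> f u \<le> f v"
      using Suc.hyps(1)[of "V - {w}"] Suc.prems by auto
    have lt: "\<rho> v < k" if "v \<in> V" "v \<noteq> w" for v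
      using bij_betwE[OF \<rho>(1)] that by auto
    have "bij_betw (\<rho>(w := k)) (insert w (V - {w})) (insert k {..<k})"
      using \<rho>(1) notIn_Un_bij_betw[of w "V - {w}" "\<rho>(w := k)" "{..<k}"]
        bij_betw_cong[of "V - {w}" \<rho> "\<rho>(w := k)" "{..<k}"]
      by simp
    then have "bij_betw (\<rho>(w := k)) V {..<card V}"
      using w(1) Suc.hyps(2)[symmetric] by (simp add: insert_absorb lessThan_Suc)
    moreover have "\<forall>u\<in>V. \<forall>v\<in>V. (\<rho>(w := k)) u < (\<rho>(w := k)) v \<longrightarrow> f u \<le> f v"
      using \<rho>(2) lt max by (auto dest: less_asym)
    ultimately show ?case by blast
  qed
  then show ?thesis using that by blast
qed

text \<open>
  The quantile form of a discrepancy bound: the number of values up to \<open>f u\<close> exceeds the rank of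
  \<open>u\<close>, and the number of values up to any \<open>h < f u\<close> is at most that rank.
\<close>

lemma rank_close_to_value:
  fixes f :: "'a \<Rightarrow> real" and \<rho> :: "'a \<Rightarrow> nat"
  assumes "finite V" and bij: "bij_betw \<rho> V {..<card V}"
    and mono: "\<And>u v. u \<in> V \<Longrightarrow> v \<in> V \<Longrightarrow> \<rho> u < \<rho> v \<Longrightarrow> f u \<le> f v"
    and range: "f ` V \<subseteq> {0..1}"
    and count: "\<And>h. 0 \<le> h \<Longrightarrow> h \<le> 1 \<Longrightarrow>
      \<bar>real (card {v \<in> V. f v \<le> h}) - real (card V) * h\<bar> \<le> E"
    and "u \<in> V"
  shows "\<bar>real (card V) * f u - real (\<rho> u)\<bar> \<le> E"
proof -
  have inj: "inj_on \<rho> V" and lt: "\<rho> u < card V"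
    using bij \<open>u \<in> V\<close> by (auto simp: bij_betw_def)
  have fu: "0 \<le> f u" "f u \<le> 1" using range \<open>u \<in> V\<close> by auto
  have card_below: "card {v \<in> V. \<rho> v < k} = k" if "k \<le> card V" for k
  proof -
    have "\<rho> ` {v \<in> V. \<rho> v < k} = {..<k}"
    proof
      show "{..<k} \<subseteq> \<rho> ` {v \<in> V. \<rho> v < k}"
      proof
        fix j assume "j \<in> {..<k}"
        then have "j \<in> \<rho> ` V" using bij that by (auto simp: bij_betw_def)
        then show "j \<in> \<rho> ` {v \<in> V. \<rho> v < k}" using \<open>j \<in> {..<k}\<close> by auto
      qed
    qed auto
    then show ?thesis
      using card_image[of \<rho> "{v \<in> V. \<rho> v < k}"] inj by (simp add: inj_on_def)
  qed
  have "f v \<le> f u" if "v \<in> V" "\<rho> v < Suc (\<rho> u)" for v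
    using mono[OF that(1) \<open>u \<in> V\<close>] that inj \<open>u \<in> V\<close>
    by (cases "v = u") (auto simp: inj_on_def less_Suc_eq)
  then have "card {v \<in> V. \<rho> v < Suc (\<rho> u)} \<le> card {v \<in> V. f v \<le> f u}"
    using \<open>finite V\<close> by (intro card_mono) auto
  then have "real (Suc (\<rho> u)) \<le> real (card {v \<in> V. f v \<le> f u})"
    using card_below[of "Suc (\<rho> u)"] lt by simp
  with count[of "f u"] fu have upper: "real (\<rho> u) \<le> real (card V) * f u + E"
    by simp
  have below: "real (card V) * h - E \<le> real (\<rho> u)" if "0 \<le> h" "h < f u" for h
  proof -
    have "\<rho> v < \<rho> u" if "v \<in> V" "f v \<le> h" for v
    proof (rule ccontr)
      assume "\<not> \<rho> v < \<rho> u"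
      then have "\<rho> u < \<rho> v \<or> v = u"
        using inj that(1) \<open>u \<in> V\<close> by (metis inj_onD linorder_neqE_nat)
      then have "f u \<le> f v"
        using mono[OF \<open>u \<in> V\<close> that(1)] by auto
      with that(2) \<open>h < f u\<close> show False by simp
    qed
    then have "card {v \<in> V. f v \<le> h} \<le> card {v \<in> V. \<rho> v < \<rho> u}"
      using \<open>finite V\<close> by (intro card_mono) auto
    then show ?thesis
      using card_below[of "\<rho> u"] lt count[of h] that fu by (simp add: abs_le_iff)
  qed
  have E: "0 \<le> E" using count[of 0] by simp
  have "real (card V) * f u - E \<le> real (\<rho> u)"
  proof (cases "f u = 0")
    case True
    then show ?thesis using E by simp
  next
    case False
    have pos: "0 < real (card V)" using lt by simp
    have "f u \<le> (real (\<rho> u) + E) / real (card V)"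
    proof (rule dense_le_bounded[of 0])
      show "0 < f u" using False fu by simp
      show "h \<le> (real (\<rho> u) + E) / real (card V)" if "0 < h" "h < f u" for h
        using below[of h] that pos by (simp add: field_simps)
    qed
    then show ?thesis using pos by (simp add: field_simps)
  qed
  with upper show ?thesis by simp
qed

definition box_count :: "nat \<Rightarrow> (nat \<Rightarrow> real \<times> real) \<Rightarrow> real \<Rightarrow> real \<Rightarrow> real \<Rightarrow> nat" where
  "box_count n p \<alpha> \<beta> h = card {i. i < n \<and> p i \<in> {\<alpha>..\<beta>} \<times> {0..h}}"

text \<open>
  The discrepancy of the sample, for the uniform distribution on the unit square, over boxes of
  width at most \<open>W\<close> that stand on the bottom side. Restricting the width makes a much smaller error
  \<open>E\<close> attainable, because the count in a box of area \<open>A\<close> fluctuates only by about \<open>sqrt (n A)\<close>.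
\<close>

definition evenly_spread :: "nat \<Rightarrow> (nat \<Rightarrow> real \<times> real) \<Rightarrow> real \<Rightarrow> real \<Rightarrow> bool" where
  "evenly_spread n p W E \<longleftrightarrow>
     (\<forall>\<alpha> \<beta> h. 0 \<le> \<alpha> \<and> \<alpha> \<le> \<beta> \<and> \<beta> \<le> 1 \<and> 0 \<le> h \<and> h \<le> 1 \<and> \<beta> - \<alpha> \<le> W \<longrightarrow>
        \<bar>real (box_count n p \<alpha> \<beta> h) - real n * (\<beta> - \<alpha>) * h\<bar> \<le> E)"

lemma evenly_spreadD:
  assumes "evenly_spread n p W E" "0 \<le> \<alpha>" "\<alpha> \<le> \<beta>" "\<beta> \<le> 1" "0 \<le> h" "h \<le> 1" "\<beta> - \<alpha> \<le> W"
  shows "\<bar>real (box_count n p \<alpha> \<beta> h) - real n * (\<beta> - \<alpha>) * h\<bar> \<le> E"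
  using assms unfolding evenly_spread_def by blast

text \<open>
  The strip \<open>V\<close> is cut out by ranks, so its position depends on the sample. It still agrees with a
  closed box up to the points on the two vertical edges, and a vertical segment is a box of width
  \<open>0\<close>, hence contains at most \<open>E\<close> points. The count is compared with the actual size of \<open>V\<close>
  instead of the size expected from its area, so that uncertainty about the exact width of the strip
  cancels.
\<close>

lemma strip_count:
  fixes n :: nat and p :: "nat \<Rightarrow> real \<times> real" and \<rho> :: "nat \<Rightarrow> nat"
  assumes pts: "\<And>i. i < n \<Longrightarrow> p i \<in> unit_square"
    and mono: "\<And>i j. i < n \<Longrightarrow> j < n \<Longrightarrow> \<rho> i < \<rho> j \<Longrightarrow> fst (p i) \<le> fst (p j)"
    and spread: "evenly_spread n p W E"
    and V: "V = {i. i < n \<and> a \<le> \<rho> i \<and> \<rho> i < b}"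
    and V0: "V \<noteq> {}"
    and narrow: "\<And>i j. i \<in> V \<Longrightarrow> j \<in> V \<Longrightarrow> fst (p i) - fst (p j) \<le> W"
    and h: "0 \<le> h" "h \<le> 1"
  shows "\<bar>real (card {i \<in> V. snd (p i) \<le> h}) - real (card V) * h\<bar> \<le> 4 * E"
proof -
  have finV: "finite V" unfolding V by simp
  let ?X = "(\<lambda>i. fst (p i)) ` V"
  have "Min ?X \<in> ?X" "Max ?X \<in> ?X"
    using V0 finV by (auto intro!: Min_in Max_in)
  then obtain k l where kl: "k \<in> V" "l \<in> V" "fst (p k) = Min ?X" "fst (p l) = Max ?X"
    by auto
  define \<xi> \<eta> where "\<xi> = fst (p k)" and "\<eta> = fst (p l)"
  have bounds: "\<xi> \<le> fst (p i)" "fst (p i) \<le> \<eta>" if "i \<in> V" for i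
    using that finV unfolding \<xi>_def \<eta>_def kl(3,4) by simp_all
  have kl_n: "k < n" "l < n" "a \<le> \<rho> k" "\<rho> l < b"
    using kl V by auto
  have sq: "0 \<le> fst (p i)" "fst (p i) \<le> 1" "0 \<le> snd (p i)" "snd (p i) \<le> 1" if "i < n" for i
    using pts[OF that] by (auto simp: unit_square_def mem_Times_iff)
  have \<xi>\<eta>: "0 \<le> \<xi>" "\<xi> \<le> \<eta>" "\<eta> \<le> 1" "\<eta> - \<xi> \<le> W" "0 \<le> W"
    using bounds(1)[OF kl(2)] sq kl_n narrow[OF kl(2,1)] narrow[OF kl(1,1)]
    by (auto simp: \<xi>_def \<eta>_def)
  have inside: "i \<in> V" if "i < n" "\<xi> < fst (p i)" "fst (p i) < \<eta>" for i
  proof -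
    have "\<not> \<rho> i < \<rho> k" "\<not> \<rho> l < \<rho> i"
      using mono[OF that(1) kl_n(1)] mono[OF kl_n(2) that(1)] that unfolding \<xi>_def \<eta>_def by linarith+
    then show ?thesis using kl_n that(1) unfolding V by auto
  qed
  define cnt where "cnt g = real (card {i \<in> V. snd (p i) \<le> g})" for g
  define R where "R g = real (box_count n p \<xi> \<eta> g)" for g
  have R: "\<bar>R g - real n * (\<eta> - \<xi>) * g\<bar> \<le> E" if "0 \<le> g" "g \<le> 1" for g
    unfolding R_def using evenly_spreadD[OF spread \<xi>\<eta>(1,2,3) that \<xi>\<eta>(4)] .
  \<comment> \<open>a degenerate box of width \<open>0\<close>\<close>
  have edge: "real (box_count n p x x g) \<le> E" if "0 \<le> g" "g \<le> 1" "0 \<le> x" "x \<le> 1" for x g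
    using evenly_spreadD[OF spread, of x x g] that \<xi>\<eta> by simp
  have lower: "cnt g \<le> R g" for g
    unfolding cnt_def R_def box_count_def using bounds sq V
    by (intro of_nat_mono card_mono) (auto simp: mem_Times_iff)
  have upper: "R g \<le> cnt g + 2 * E" if "0 \<le> g" "g \<le> 1" for g
  proof -
    have "{i. i < n \<and> p i \<in> {\<xi>..\<eta>} \<times> {0..g}} \<subseteq> {i \<in> V. snd (p i) \<le> g} \<union>
        ({i. i < n \<and> p i \<in> {\<xi>..\<xi>} \<times> {0..g}} \<union> {i. i < n \<and> p i \<in> {\<eta>..\<eta>} \<times> {0..g}})"
    proof
      fix i assume i: "i \<in> {i. i < n \<and> p i \<in> {\<xi>..\<eta>} \<times> {0..g}}"
      then have "i \<in> V \<or> fst (p i) = \<xi> \<or> fst (p i) = \<eta>"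
        using inside[of i] le_less[of \<xi> "fst (p i)"] le_less[of "fst (p i)" \<eta>]
        by (auto simp: mem_Times_iff)
      with i show "i \<in> {i \<in> V. snd (p i) \<le> g} \<union>
        ({i. i < n \<and> p i \<in> {\<xi>..\<xi>} \<times> {0..g}} \<union> {i. i < n \<and> p i \<in> {\<eta>..\<eta>} \<times> {0..g}})"
        by (auto simp: mem_Times_iff)
    qed
    then have "box_count n p \<xi> \<eta> g \<le> card ({i \<in> V. snd (p i) \<le> g} \<union>
        ({i. i < n \<and> p i \<in> {\<xi>..\<xi>} \<times> {0..g}} \<union> {i. i < n \<and> p i \<in> {\<eta>..\<eta>} \<times> {0..g}}))"
      unfolding box_count_def using finV by (intro card_mono) auto
    also have "\<dots> \<le> card {i \<in> V. snd (p i) \<le> g} + (box_count n p \<xi> \<xi> g + box_count n p \<eta> \<eta> g)"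
      unfolding box_count_def by (intro order_trans[OF card_Un_le] add_left_mono card_Un_le)
    finally have "R g \<le> cnt g + (real (box_count n p \<xi> \<xi> g) + real (box_count n p \<eta> \<eta> g))"
      unfolding R_def cnt_def by linarith
    then show ?thesis
      using edge[OF that, of \<xi>] edge[OF that, of \<eta>] \<xi>\<eta> by linarith
  qed
  have "{i \<in> V. snd (p i) \<le> 1} = V" using sq unfolding V by auto
  then have all: "cnt 1 = real (card V)" by (simp add: cnt_def)
  define d where "d = real n * (\<eta> - \<xi>)"
  have E: "0 \<le> E" using R[OF h] by linarith
  have w: "d - 3 * E \<le> real (card V)" "real (card V) \<le> d + E"
    using R[of 1] lower[of 1] upper[of 1] all by (auto simp: d_def abs_le_iff)
  have "cnt h \<le> d * h + E" "d * h - 3 * E \<le> cnt h"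
    using R[OF h] lower[of h] upper[OF h] by (auto simp: d_def abs_le_iff)
  moreover have "d * h \<le> (real (card V) + 3 * E) * h" "(real (card V) - E) * h \<le> d * h"
    using w h by (auto intro!: mult_right_mono)
  moreover have "E * h \<le> E" using E h by (simp add: mult_left_le)
  ultimately show ?thesis
    unfolding cnt_def by (auto simp: abs_le_iff algebra_simps)
qed

text \<open>
  A strip of \<open>(B - A) N\<close> points fills the grid columns \<open>A..<B\<close> row by row, in the order of the
  second coordinate. Which of the \<open>B - A\<close> columns a point receives is immaterial for the first
  coordinate, as the whole strip is narrow.
\<close>

lemma place_strip:
  fixes n N A B s :: nat and p :: "nat \<Rightarrow> real \<times> real" and \<rho> :: "nat \<Rightarrow> nat"
  assumes n: "n = N\<^sup>2"
    and pts: "\<And>i. i < n \<Longrightarrow> p i \<in> unit_square"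
    and bij: "bij_betw \<rho> {..<n} {..<n}"
    and mono: "\<And>i j. i < n \<Longrightarrow> j < n \<Longrightarrow> \<rho> i < \<rho> j \<Longrightarrow> fst (p i) \<le> fst (p j)"
    and xrank: "\<And>i. i < n \<Longrightarrow> \<bar>real n * fst (p i) - real (\<rho> i)\<bar> \<le> E1"
    and spread: "evenly_spread n p W E"
    and W: "2 * real s / real N + 2 * E1 / real n \<le> W"
    and AB: "0 < s" "A + s \<le> B" "B \<le> A + 2 * s" "B \<le> N"
    and V: "V = {i. i < n \<and> A * N \<le> \<rho> i \<and> \<rho> i < B * N}"
  shows "\<exists>g. inj_on g V \<and> g ` V \<subseteq> {A..<B} \<times> {..<N} \<and>
    (\<forall>i\<in>V. \<bar>fst (p i) - real (fst (g i)) / real N\<bar> \<le> 2 * real s / real N + E1 / real n \<and>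
           \<bar>snd (p i) - real (snd (g i)) / real N\<bar> \<le> 1 / real N + 4 * E / (real s * real N))"
proof -
  have N: "0 < N" using AB by linarith
  then have npos: "0 < n" using n by simp
  have finV: "finite V" unfolding V by simp
  have "\<rho> ` V = {A * N..<B * N}"
  proof
    show "{A * N..<B * N} \<subseteq> \<rho> ` V"
    proof
      fix j assume j: "j \<in> {A * N..<B * N}"
      moreover have "B * N \<le> n" using AB(4) by (simp add: n power2_eq_square)
      ultimately have "j \<in> {..<n}" by auto
      then have "j \<in> \<rho> ` {..<n}" using bij by (simp add: bij_betw_def)
      then show "j \<in> \<rho> ` V" using j unfolding V by auto
    qed
  qed (auto simp: V)
  moreover have "inj_on \<rho> V"
    using bij unfolding V by (auto simp: bij_betw_def inj_on_def)
  ultimately have cardV: "card V = (B - A) * N"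
    by (metis card_image card_atLeastLessThan diff_mult_distrib)
  have xbounds: "real (A * N) - E1 \<le> real n * fst (p i)" "real n * fst (p i) \<le> real (B * N) + E1" if "i \<in> V" for i
  proof -
    have "i < n" "real (A * N) \<le> real (\<rho> i)" "real (\<rho> i) \<le> real (B * N)"
      using that unfolding V by (auto simp del: of_nat_mult)
    with xrank[OF this(1)] show "real (A * N) - E1 \<le> real n * fst (p i)" "real n * fst (p i) \<le> real (B * N) + E1"
      by linarith+
  qed
  have BA: "real B - real A \<le> 2 * real s" "real s \<le> real B - real A" using AB by linarith+
  have narrow: "fst (p i) - fst (p j) \<le> W" if "i \<in> V" "j \<in> V" for i j
  proof -
    have "real n * (fst (p i) - fst (p j)) \<le> (real B - real A) * real N + 2 * E1"
      using xbounds(2)[OF that(1)] xbounds(1)[OF that(2)] by (simp add: algebra_simps)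
    also have "\<dots> \<le> 2 * real s * real N + 2 * E1"
      using BA by (intro add_right_mono mult_right_mono) auto
    also have "\<dots> = real n * (2 * real s / real N + 2 * E1 / real n)"
      using N by (simp add: n power2_eq_square field_simps)
    finally have "fst (p i) - fst (p j) \<le> 2 * real s / real N + 2 * E1 / real n"
      using npos by simp
    with W show ?thesis by linarith
  qed
  obtain \<sigma> where \<sigma>: "bij_betw \<sigma> V {..<card V}"
      "\<And>u v. u \<in> V \<Longrightarrow> v \<in> V \<Longrightarrow> \<sigma> u < \<sigma> v \<Longrightarrow> snd (p u) \<le> snd (p v)"
    using ex_monotone_ranking[OF finV, of "\<lambda>i. snd (p i)"] by blast
  have yrank: "\<bar>real (card V) * snd (p i) - real (\<sigma> i)\<bar> \<le> 4 * E" if "i \<in> V" for i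
  proof (rule rank_close_to_value[OF finV \<sigma> _ _ that])
    show "(\<lambda>i. snd (p i)) ` V \<subseteq> {0..1}"
      using pts unfolding V by (auto simp: unit_square_def mem_Times_iff)
    show "\<bar>real (card {v \<in> V. snd (p v) \<le> h}) - real (card V) * h\<bar> \<le> 4 * E" if "0 \<le> h" "h \<le> 1" for h
      using strip_count[OF pts mono spread V _ narrow that] \<open>i \<in> V\<close> by blast
  qed auto
  define b where "b = B - A"
  have b: "0 < b" "real b = real B - real A" using AB by (auto simp: b_def)
  define g where "g i = (A + \<sigma> i mod b, \<sigma> i div b)" for i
  have inj: "inj_on g V"
  proof (rule inj_onI)
    fix u v assume uv: "u \<in> V" "v \<in> V" "g u = g v"
    then have "\<sigma> u div b * b + \<sigma> u mod b = \<sigma> v div b * b + \<sigma> v mod b"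
      by (simp add: g_def)
    then have "\<sigma> u = \<sigma> v" by simp
    with uv \<sigma>(1) show "u = v" by (auto simp: bij_betw_def inj_on_def)
  qed
  have \<sigma>_less: "\<sigma> i < b * N" if "i \<in> V" for i
    using bij_betwE[OF \<sigma>(1)] that cardV by (auto simp: b_def)
  have grid: "g ` V \<subseteq> {A..<B} \<times> {..<N}"
  proof -
    have "\<sigma> i mod b < B - A" for i
      using mod_less_divisor[OF b(1), of "\<sigma> i"] by (simp add: b_def)
    then have "A + \<sigma> i mod b < B" for i by (metis less_diff_conv add.commute)
    then show ?thesis
      using \<sigma>_less b(1) by (auto simp: g_def less_mult_imp_div_less mult.commute)
  qed
  have "\<bar>fst (p i) - real (fst (g i)) / real N\<bar> \<le> 2 * real s / real N + E1 / real n"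
    if "i \<in> V" for i
  proof -
    have "g i \<in> {A..<B} \<times> {..<N}" using grid that by blast
    then have "real A \<le> real (fst (g i))" "real (fst (g i)) \<le> real B"
      by (auto simp: mem_Times_iff)
    then have "real A * real N \<le> real (fst (g i)) * real N" "real (fst (g i)) * real N \<le> real B * real N"
      by (auto intro: mult_right_mono)
    moreover have "(real B - real A) * real N \<le> 2 * real s * real N"
      using BA by (intro mult_right_mono) auto
    ultimately have "\<bar>real n * fst (p i) - real (fst (g i)) * real N\<bar> \<le> 2 * real s * real N + E1"
      using xbounds[OF that] by (simp add: abs_le_iff algebra_simps)
    moreover have "real n * fst (p i) - real (fst (g i)) * real N
        = real n * (fst (p i) - real (fst (g i)) / real N)"
      using N by (simp add: n power2_eq_square field_simps)
    moreover have "2 * real s * real N + E1 = real n * (2 * real s / real N + E1 / real n)"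
      using N by (simp add: n power2_eq_square field_simps)
    ultimately have "real n * \<bar>fst (p i) - real (fst (g i)) / real N\<bar> \<le> real n * (2 * real s / real N + E1 / real n)"
      by (simp add: abs_mult)
    then show ?thesis using npos by simp
  qed
  moreover have "\<bar>snd (p i) - real (snd (g i)) / real N\<bar> \<le> 1 / real N + 4 * E / (real s * real N)"
    if "i \<in> V" for i
  proof -
    have E: "0 \<le> E" using yrank[OF that] by linarith
    have "b * snd (g i) \<le> \<sigma> i" "\<sigma> i \<le> b * snd (g i) + b"
      using mult_div_mod_eq[of b "\<sigma> i"] mod_less_divisor[OF b(1), of "\<sigma> i"]
      unfolding g_def snd_conv by linarith+
    then have "real b * real (snd (g i)) \<le> real (\<sigma> i)" "real (\<sigma> i) \<le> real b * real (snd (g i)) + real b"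
      by (simp_all flip: of_nat_mult of_nat_add)
    then have "\<bar>real b * real N * snd (p i) - real b * real (snd (g i))\<bar> \<le> real b + 4 * E"
      using yrank[OF that] cardV by (simp add: b_def abs_le_iff)
    moreover have "real b * real N * snd (p i) - real b * real (snd (g i))
        = (real b * real N) * (snd (p i) - real (snd (g i)) / real N)"
      using N by (simp add: field_simps)
    ultimately have "(real b * real N) * \<bar>snd (p i) - real (snd (g i)) / real N\<bar> \<le> real b + 4 * E"
      by (simp add: abs_mult)
    then have "\<bar>snd (p i) - real (snd (g i)) / real N\<bar> \<le> (real b + 4 * E) / (real b * real N)"
      using b(1) N by (simp add: pos_le_divide_eq mult.commute)
    also have "\<dots> = 1 / real N + 4 * E / (real b * real N)"
      using b(1) N by (simp add: field_simps)
    also have "\<dots> \<le> 1 / real N + 4 * E / (real s * real N)"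
      using BA b AB(1) N E by (intro add_left_mono divide_left_mono mult_right_mono mult_pos_pos) auto
    finally show ?thesis .
  qed
  ultimately show ?thesis using inj grid by blast
qed

text \<open>
  Since \<open>s\<close> need not divide \<open>N\<close>, the remainder is merged into the last interval. A short last
  interval would give a strip with too few points for ranks to be reliable. Here \<open>lo a\<close> and
  \<open>hi a\<close> are the end points of the interval that contains \<open>a\<close>.
\<close>

lemma ex_interval_partition:
  fixes N s :: nat
  assumes "0 < s" "s \<le> N"
  shows "\<exists>lo hi :: nat \<Rightarrow> nat.
    (\<forall>a<N. lo a \<le> a \<and> a < hi a \<and> hi a \<le> N \<and> lo a + s \<le> hi a \<and> hi a \<le> lo a + 2 * s) \<and>
    (\<forall>a<N. \<forall>a'. lo a \<le> a' \<and> a' < hi a \<longrightarrow> lo a' = lo a \<and> hi a' = hi a)"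
proof -
  \<comment> \<open>\<open>K\<close> intervals, all of length \<open>s\<close> except for the last one\<close>
  define K where "K = N div s"
  have K: "0 < K" "K * s \<le> N"
    using assms by (auto simp: K_def div_greater_zero_iff)
  have NK: "N < K * s + s"
    using dividend_less_div_times[OF assms(1), of N] by (simp add: K_def)
  define J where "J a = min (a div s) (K - 1)" for a
  define lo where "lo a = J a * s" for a
  define hi where "hi a = (if J a = K - 1 then N else J a * s + s)" for a
  have J_le: "J a \<le> K - 1" "J a * s \<le> a" for a
  proof -
    show "J a \<le> K - 1" by (simp add: J_def)
    have "J a * s \<le> a div s * s" by (simp add: J_def)
    then show "J a * s \<le> a" using div_times_less_eq_dividend order_trans by blast
  qed
  have J_less: "a < J a * s + s" if "J a \<noteq> K - 1" for a
  proof -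
    have "J a = a div s" using that by (simp add: J_def min_def split: if_splits)
    then show ?thesis using dividend_less_div_times[OF assms(1), of a] by simp
  qed
  have J_last: "J a = K - 1" if "(K - 1) * s \<le> a" for a
  proof -
    have "K - 1 \<le> a div s" using that assms(1) by (simp add: less_eq_div_iff_mult_less_eq)
    then show ?thesis by (simp add: J_def)
  qed
  have J_eq: "J a = j" if "j * s \<le> a" "a < j * s + s" "j \<le> K - 1" for a j
  proof -
    have "a div s = j"
      by (rule div_nat_eqI) (use that in \<open>auto simp: algebra_simps\<close>)
    then show ?thesis using that(3) by (simp add: J_def)
  qed
  have Kplus: "K * s = (K - 1) * s + s"
    using K(1) by (cases K) auto
  have small: "j * s + s \<le> (K - 1) * s" if "j < K - 1" for j
    using mult_le_mono1[of "Suc j" "K - 1" s] that by simp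
  have "lo a \<le> a \<and> a < hi a \<and> hi a \<le> N \<and> lo a + s \<le> hi a \<and> hi a \<le> lo a + 2 * s" if "a < N" for a
  proof (cases "J a = K - 1")
    case True
    then have "lo a = (K - 1) * s" "hi a = N" by (simp_all add: lo_def hi_def)
    then show ?thesis using that J_le(2)[of a] True K NK Kplus by simp
  next
    case False
    then have "lo a = J a * s" "hi a = J a * s + s" "J a < K - 1"
      using J_le(1)[of a] by (simp_all add: lo_def hi_def)
    then show ?thesis using that J_le(2)[of a] J_less[OF False] K Kplus small[of "J a"] by simp
  qed
  moreover have "lo a' = lo a \<and> hi a' = hi a" if "a < N" "lo a \<le> a'" "a' < hi a" for a a'
  proof -
    have "J a' = J a"
    proof (cases "J a = K - 1")
      case True
      then show ?thesis using that(2) J_last[of a'] by (simp add: lo_def)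
    next
      case False
      then show ?thesis using that(2,3) J_eq[of "J a" a'] J_le(1)[of a] by (simp add: lo_def hi_def)
    qed
    then show ?thesis by (simp add: lo_def hi_def)
  qed
  ultimately show ?thesis by blast
qed

lemma place_on_grid:
  fixes n N s :: nat and p :: "nat \<Rightarrow> real \<times> real"
  assumes n: "n = N\<^sup>2"
    and pts: "\<And>i. i < n \<Longrightarrow> p i \<in> unit_square"
    and coarse: "evenly_spread n p 1 E1"
    and fine: "evenly_spread n p W E"
    and s: "0 < s" "s \<le> N"
    and W: "2 * real s / real N + 2 * E1 / real n \<le> W"
  shows "\<exists>g. inj_on g {..<n} \<and> g ` {..<n} \<subseteq> {..<N} \<times> {..<N} \<and>
    (\<forall>i<n. \<bar>fst (p i) - real (fst (g i)) / real N\<bar> \<le> 2 * real s / real N + E1 / real n \<and>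
           \<bar>snd (p i) - real (snd (g i)) / real N\<bar> \<le> 1 / real N + 4 * E / (real s * real N))"
proof -
  have N: "0 < N" using s by simp
  obtain \<rho> where \<rho>: "bij_betw \<rho> {..<n} {..<n}"
      "\<And>u v. u \<in> {..<n} \<Longrightarrow> v \<in> {..<n} \<Longrightarrow> \<rho> u < \<rho> v \<Longrightarrow> fst (p u) \<le> fst (p v)"
    using ex_monotone_ranking[of "{..<n}" "\<lambda>i. fst (p i)"] by auto
  have xrank: "\<bar>real n * fst (p i) - real (\<rho> i)\<bar> \<le> E1" if "i < n" for i
  proof -
    have "\<bar>real (card {..<n}) * fst (p i) - real (\<rho> i)\<bar> \<le> E1"
    proof (rule rank_close_to_value[of "{..<n}" \<rho> "\<lambda>i. fst (p i)"])
      show "bij_betw \<rho> {..<n} {..<card {..<n}}" using \<rho>(1) by simp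
      show "fst (p u) \<le> fst (p v)" if "u \<in> {..<n}" "v \<in> {..<n}" "\<rho> u < \<rho> v" for u v
        using \<rho>(2) that .
      show "(\<lambda>i. fst (p i)) ` {..<n} \<subseteq> {0..1}"
        using pts by (auto simp: unit_square_def mem_Times_iff)
      fix h :: real assume h: "0 \<le> h" "h \<le> 1"
      have "{v \<in> {..<n}. fst (p v) \<le> h} = {i. i < n \<and> p i \<in> {0..h} \<times> {0..1}}"
        using pts by (auto simp: unit_square_def mem_Times_iff)
      then show "\<bar>real (card {v \<in> {..<n}. fst (p v) \<le> h}) - real (card {..<n}) * h\<bar> \<le> E1"
        using evenly_spreadD[OF coarse, of 0 h 1] h by (simp add: box_count_def)
    qed (use \<open>i < n\<close> in simp_all)
    then show ?thesis by simp
  qed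
  from ex_interval_partition[OF s] obtain lo hi :: "nat \<Rightarrow> nat" where
    lohi0: "\<forall>a<N. lo a \<le> a \<and> a < hi a \<and> hi a \<le> N \<and> lo a + s \<le> hi a \<and> hi a \<le> lo a + 2 * s"
    and same0: "\<forall>a<N. \<forall>a'. lo a \<le> a' \<and> a' < hi a \<longrightarrow> lo a' = lo a \<and> hi a' = hi a"
    by (elim exE conjE) (rule that)
  have lohi: "\<And>a. a < N \<Longrightarrow> lo a \<le> a \<and> a < hi a \<and> hi a \<le> N \<and> lo a + s \<le> hi a \<and> hi a \<le> lo a + 2 * s"
    and same: "\<And>a a'. a < N \<Longrightarrow> lo a \<le> a' \<Longrightarrow> a' < hi a \<Longrightarrow> lo a' = lo a \<and> hi a' = hi a"
    using lohi0 same0 by blast+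
  define V where "V A B = {i. i < n \<and> A * N \<le> \<rho> i \<and> \<rho> i < B * N}" for A B
  define good where "good A B g \<longleftrightarrow> inj_on g (V A B) \<and> g ` V A B \<subseteq> {A..<B} \<times> {..<N} \<and>
    (\<forall>i\<in>V A B. \<bar>fst (p i) - real (fst (g i)) / real N\<bar> \<le> 2 * real s / real N + E1 / real n \<and>
           \<bar>snd (p i) - real (snd (g i)) / real N\<bar> \<le> 1 / real N + 4 * E / (real s * real N))"
    for A B and g :: "nat \<Rightarrow> nat \<times> nat"
  define G where "G A B = (SOME g. good A B g)" for A B
  have G: "good (lo a) (hi a) (G (lo a) (hi a))" if "a < N" for a
  proof -
    have "\<exists>g. good (lo a) (hi a) g"
      unfolding good_def
      by (rule place_strip[OF n pts \<rho>(1) _ xrank fine W s(1) _ _ _ V_def]) (use \<rho>(2) lohi[OF that] in auto)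
    then show ?thesis unfolding G_def by (rule someI_ex)
  qed
  define col where "col i = \<rho> i div N" for i
  define g where "g i = G (lo (col i)) (hi (col i)) i" for i
  have col: "col i < N" if "i < n" for i
    using bij_betwE[OF \<rho>(1)] that N by (auto simp: col_def n power2_eq_square less_mult_imp_div_less)
  have inV: "i \<in> V (lo (col i)) (hi (col i))" if "i < n" for i
  proof -
    have "lo (col i) \<le> \<rho> i div N" "\<rho> i div N < hi (col i)"
      using lohi[OF col[OF that]] by (auto simp: col_def)
    then show ?thesis
      using that N by (simp add: V_def less_eq_div_iff_mult_less_eq div_less_iff_less_mult)
  qed
  have gi: "fst (g i) \<in> {lo (col i)..<hi (col i)}" "snd (g i) < N" if "i < n" for i
  proof -
    have "g i \<in> {lo (col i)..<hi (col i)} \<times> {..<N}"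
      using G[OF col[OF that]] inV[OF that] unfolding good_def g_def by blast
    then show "fst (g i) \<in> {lo (col i)..<hi (col i)}" "snd (g i) < N"
      by (auto simp: mem_Times_iff)
  qed
  \<comment> \<open>the column assigned to \<open>i\<close> reveals its strip, so different strips do not interfere\<close>
  have cell: "lo (fst (g i)) = lo (col i) \<and> hi (fst (g i)) = hi (col i)" if "i < n" for i
    by (rule same[OF col[OF that]]) (use gi(1)[OF that] in simp_all)
  have "inj_on g {..<n}"
  proof (rule inj_onI)
    fix i j assume ij: "i \<in> {..<n}" "j \<in> {..<n}" "g i = g j"
    then have eq: "lo (col i) = lo (col j)" "hi (col i) = hi (col j)"
      using cell[of i] cell[of j] by simp_all
    have "good (lo (col i)) (hi (col i)) (G (lo (col i)) (hi (col i)))"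
      using G[OF col, of i] ij(1) by simp
    then have "inj_on (G (lo (col i)) (hi (col i))) (V (lo (col i)) (hi (col i)))"
      unfolding good_def by (rule conjunct1)
    moreover have "G (lo (col i)) (hi (col i)) i = G (lo (col i)) (hi (col i)) j"
      using ij(3) eq by (simp add: g_def)
    moreover have "i \<in> V (lo (col i)) (hi (col i))"
      using inV[of i] ij(1) by simp
    moreover have "j \<in> V (lo (col i)) (hi (col i))"
      using inV[of j] ij(2) eq by simp
    ultimately show "i = j" by (rule inj_onD)
  qed
  moreover have "g ` {..<n} \<subseteq> {..<N} \<times> {..<N}"
  proof (rule image_subsetI)
    fix i assume "i \<in> {..<n}"
    then have "i < n" by simp
    then show "g i \<in> {..<N} \<times> {..<N}"
      using gi[of i] lohi[OF col, of i] by (auto simp: mem_Times_iff)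
  qed
  moreover have "\<forall>i<n. \<bar>fst (p i) - real (fst (g i)) / real N\<bar> \<le> 2 * real s / real N + E1 / real n \<and>
           \<bar>snd (p i) - real (snd (g i)) / real N\<bar> \<le> 1 / real N + 4 * E / (real s * real N)"
  proof (intro allI impI)
    fix i assume "i < n"
    show "\<bar>fst (p i) - real (fst (g i)) / real N\<bar> \<le> 2 * real s / real N + E1 / real n \<and>
           \<bar>snd (p i) - real (snd (g i)) / real N\<bar> \<le> 1 / real N + 4 * E / (real s * real N)"
      using G[OF col[OF \<open>i < n\<close>]] inV[OF \<open>i < n\<close>] unfolding good_def g_def by blast
  qed
  ultimately show ?thesis by blast
qed

text \<open>
  Two adjacent points are less than \<open>r\<close> apart, so their grid points are less than \<open>r + 2 D\<close> apart in
  each coordinate, after scaling by \<open>1 / N\<close>. This is at most \<open>(sqrt N - 2) / N\<close>, and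
  \<open>sqrt N - 2 < q - 1\<close>.
\<close>

lemma optimal_if_evenly_spread:
  fixes n N s :: nat and p :: "nat \<Rightarrow> real \<times> real"
  assumes n: "n = N\<^sup>2"
    and pts: "\<And>i. i < n \<Longrightarrow> p i \<in> unit_square"
    and coarse: "evenly_spread n p 1 E1"
    and fine: "evenly_spread n p W E"
    and s: "0 < s" "s \<le> N"
    and W: "2 * real s / real N + 2 * E1 / real n \<le> W"
    and D1: "2 * real s / real N + E1 / real n \<le> D"
    and D2: "1 / real N + 4 * E / (real s * real N) \<le> D"
    and r: "r + 2 * D \<le> (sqrt (real N) - 2) / real N"
  shows "has_optimal_orthogonal_colouring {..<n} (geometric_adj r p)"
proof -
  have N: "0 < N" using s by simp
  define q where "q = nat \<lfloor>sqrt (real N)\<rfloor>"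
  have "real q \<le> sqrt (real N)" and q: "sqrt (real N) < real q + 1"
    using N by (auto simp: q_def)
  then have "(real q)\<^sup>2 \<le> real N"
    using power_mono[of "real q" "sqrt (real N)" 2] by simp
  then have qN: "q\<^sup>2 \<le> N" by (simp flip: of_nat_power)
  from place_on_grid[OF n pts coarse fine s W] obtain g where
    g: "inj_on g {..<n}" "g ` {..<n} \<subseteq> {..<N} \<times> {..<N}"
      "\<And>i. i < n \<Longrightarrow> \<bar>fst (p i) - real (fst (g i)) / real N\<bar> \<le> D"
      "\<And>i. i < n \<Longrightarrow> \<bar>snd (p i) - real (snd (g i)) / real N\<bar> \<le> D"
    by (blast intro: order_trans[OF _ D1] order_trans[OF _ D2])
  have near: "\<bar>int a - int b\<bar> < int q - 1"
    if "\<bar>x - real a / real N\<bar> \<le> D" "\<bar>y - real b / real N\<bar> \<le> D" "\<bar>x - y\<bar> < r" for x y :: real and a b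
  proof -
    have "\<bar>real a / real N - real b / real N\<bar> < (sqrt (real N) - 2) / real N"
      using that r by linarith
    then have "\<bar>real a - real b\<bar> / real N < (sqrt (real N) - 2) / real N"
      by (simp flip: diff_divide_distrib)
    then have "\<bar>real a - real b\<bar> < sqrt (real N) - 2"
      using N by (simp add: divide_less_cancel)
    with q have "\<bar>real a - real b\<bar> < real q - 1" by linarith
    then have "real_of_int \<bar>int a - int b\<bar> < real_of_int (int q - 1)" by simp
    then show ?thesis by (simp only: of_int_less_iff)
  qed
  have "orthogonally_colourable {..<n} (geometric_adj r p) N"
  proof (rule orthogonally_colourable_from_grid[OF N qN g(1,2)])
    fix u v assume uv: "u \<in> {..<n}" "v \<in> {..<n}" "geometric_adj r p u v"
    then have "dist (fst (p u)) (fst (p v)) < r" "dist (snd (p u)) (snd (p v)) < r"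
      by (auto simp: geometric_adj_def intro: order_le_less_trans[OF dist_fst_le] order_le_less_trans[OF dist_snd_le])
    then show "\<bar>int (fst (g u)) - int (fst (g v))\<bar> < int q - 1 \<and>
        \<bar>int (snd (g u)) - int (snd (g v))\<bar> < int q - 1"
      using near[OF g(3,3), of u v] near[OF g(4,4), of u v] uv(1,2) by (simp add: dist_real_def)
  qed (simp add: geometric_adj_def)
  then show ?thesis
    by (rule has_optimal_orthogonal_colouring_square) (auto simp: n)
qed

section \<open>Concentration of the number of sample points in boxes\<close>

lemma exp_le_quadratic:
  fixes x :: real
  assumes "\<bar>x\<bar> \<le> 1"
  shows "exp x \<le> 1 + x + x\<^sup>2"
proof (cases "0 \<le> x")
  case True
  then show ?thesis using exp_bound[of x] assms by simp
next
  case False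
  \<comment> \<open>for negative arguments, take reciprocals in \<open>1 + y \<le> exp y\<close>\<close>
  define y where "y = - x"
  have y: "0 \<le> y" using False by (simp add: y_def)
  have "1 \<le> (1 - y + y\<^sup>2) * (1 + y)"
    using y by (simp add: power2_eq_square algebra_simps)
  also have "\<dots> \<le> (1 - y + y\<^sup>2) * exp y"
  proof (rule mult_left_mono)
    show "1 + y \<le> exp y" using exp_ge_add_one_self[of y] by simp
    \<comment> \<open>completing the square\<close>
    have "0 \<le> (1 - y / 2)\<^sup>2 + 3 / 4 * y\<^sup>2" by simp
    then show "0 \<le> 1 - y + y\<^sup>2" by (simp add: power2_eq_square field_simps)
  qed
  finally have "exp (- y) \<le> 1 - y + y\<^sup>2"
    by (simp add: exp_minus field_simps)
  then show ?thesis by (simp add: y_def)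
qed

text \<open>
  The count is a sum of independent indicators, so its exponential is a product of independent
  factors.
\<close>

lemma expectation_exp_count:
  fixes M :: "'a measure" and n :: nat and \<theta> :: real
  assumes "prob_space M" and A: "A \<in> sets M"
  shows "integrable (Pi\<^sub>M {..<n} (\<lambda>_. M)) (\<lambda>x. exp (\<theta> * real (card {i. i < n \<and> x i \<in> A})))"
    and "(\<integral>x. exp (\<theta> * real (card {i. i < n \<and> x i \<in> A})) \<partial>Pi\<^sub>M {..<n} (\<lambda>_. M))
      = (1 + measure M A * (exp \<theta> - 1)) ^ n"
proof -
  interpret prob_space M by fact
  interpret P: product_sigma_finite "\<lambda>_::nat. M" by unfold_locales
  have count: "real (card {i. i < n \<and> x i \<in> A}) = (\<Sum>i<n. indicator A (x i))" for x
  proof -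
    have "{i. i < n \<and> x i \<in> A} = {i \<in> {..<n}. x i \<in> A}" by auto
    then show ?thesis by (simp add: indicator_def sum.If_cases Int_def)
  qed
  have prod: "exp (\<theta> * real (card {i. i < n \<and> x i \<in> A})) = (\<Prod>i<n. exp (\<theta> * indicator A (x i)))" for x
    unfolding count sum_distrib_left by (simp only: exp_sum finite_lessThan)
  have affine: "exp (\<theta> * indicator A y) = 1 + (exp \<theta> - 1) * indicator A y" for y
    by (simp add: indicator_def)
  have int: "integrable M (\<lambda>y. exp (\<theta> * indicator A y))"
    unfolding affine using A by (intro Bochner_Integration.integrable_add integrable_mult_right) (auto simp: less_top[symmetric])
  show "integrable (Pi\<^sub>M {..<n} (\<lambda>_. M)) (\<lambda>x. exp (\<theta> * real (card {i. i < n \<and> x i \<in> A})))"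
    unfolding prod using int by (intro P.product_integrable_prod) auto
  have "(\<integral>y. exp (\<theta> * indicator A y) \<partial>M) = 1 + measure M A * (exp \<theta> - 1)"
    unfolding affine using A by (simp add: less_top[symmetric] prob_space)
  then show "(\<integral>x. exp (\<theta> * real (card {i. i < n \<and> x i \<in> A})) \<partial>Pi\<^sub>M {..<n} (\<lambda>_. M))
      = (1 + measure M A * (exp \<theta> - 1)) ^ n"
    unfolding prod using int by (subst P.product_integral_prod) auto
qed

text \<open>
  Markov's inequality for \<open>exp (\<theta> D)\<close> with \<open>\<theta> = \<plusminus> a / (2 n P)\<close>, which minimises
  \<open>n P \<theta>\<^sup>2 - \<bar>\<theta>\<bar> a\<close>. The upper bound on \<open>a\<close> keeps \<open>\<bar>\<theta>\<bar> \<le> 1\<close>, where the quadratic estimate of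
  \<open>exp\<close> is valid. The exponent has the variance proxy \<open>n P\<close> in place of \<open>n\<close>, which is what makes
  the bound strong for narrow boxes.
\<close>

lemma chernoff_count:
  fixes M :: "'a measure" and n :: nat and a P :: real
  assumes M: "prob_space M" and A: "A \<in> sets M"
    and P: "measure M A \<le> P" and a: "0 < a" "a \<le> 2 * real n * P"
  defines "D \<equiv> \<lambda>x. real (card {i. i < n \<and> x i \<in> A}) - real n * measure M A"
  shows "{x \<in> space (Pi\<^sub>M {..<n} (\<lambda>_. M)). a < \<bar>D x\<bar>} \<in> sets (Pi\<^sub>M {..<n} (\<lambda>_. M))"
    and "measure (Pi\<^sub>M {..<n} (\<lambda>_. M)) {x \<in> space (Pi\<^sub>M {..<n} (\<lambda>_. M)). a < \<bar>D x\<bar>}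
      \<le> 2 * exp (- a\<^sup>2 / (4 * real n * P))"
proof -
  let ?\<Omega> = "Pi\<^sub>M {..<n} (\<lambda>_. M)"
  interpret \<Omega>: prob_space ?\<Omega> by (intro prob_space_PiM M)
  \<comment> \<open>measurability of the count, read off from the integrability of its exponential\<close>
  have "(\<lambda>x. ln (exp (1 * real (card {i. i < n \<and> x i \<in> A})))) \<in> borel_measurable ?\<Omega>"
    by (rule borel_measurable_ln[OF borel_measurable_integrable[OF expectation_exp_count(1)[OF M A]]])
  then have "(\<lambda>x. real (card {i. i < n \<and> x i \<in> A})) \<in> borel_measurable ?\<Omega>"
    by (simp only: mult_1 ln_exp)
  then have D_meas[measurable]: "D \<in> borel_measurable ?\<Omega>"
    unfolding D_def by (rule borel_measurable_diff) (rule borel_measurable_const)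
  show "{x \<in> space ?\<Omega>. a < \<bar>D x\<bar>} \<in> sets ?\<Omega>" by measurable
  have nP: "0 < real n * P" using a by linarith
  define l where "l = a / (2 * real n * P)"
  have l: "0 < l" "l \<le> 1" using a nP by (auto simp: l_def field_simps)
  have tail: "measure ?\<Omega> {x \<in> space ?\<Omega>. exp (l * a) \<le> exp (\<theta> * D x)} \<le> exp (- a\<^sup>2 / (4 * real n * P))"
    if \<theta>: "\<bar>\<theta>\<bar> = l" for \<theta>
  proof -
    define c where "c = exp (- \<theta> * (real n * measure M A))"
    have split: "exp (\<theta> * D x) = c * exp (\<theta> * real (card {i. i < n \<and> x i \<in> A}))" for x
      by (simp add: D_def c_def exp_add[symmetric] algebra_simps)
    have p: "0 \<le> measure M A" "measure M A \<le> 1" using prob_space.prob_le_1[OF M] by auto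
    have "1 + measure M A * (exp \<theta> - 1) \<le> exp (measure M A * (exp \<theta> - 1))"
      by (rule exp_ge_add_one_self)
    also have "\<dots> \<le> exp (measure M A * (\<theta> + \<theta>\<^sup>2))"
    proof -
      have "exp \<theta> - 1 \<le> \<theta> + \<theta>\<^sup>2" using exp_le_quadratic[of \<theta>] \<theta> l by linarith
      then show ?thesis using p(1) by (simp add: mult_left_mono)
    qed
    finally have base: "1 + measure M A * (exp \<theta> - 1) \<le> exp (measure M A * (\<theta> + \<theta>\<^sup>2))" .
    have "0 \<le> (1 - measure M A) + measure M A * exp \<theta>" using p by (intro add_nonneg_nonneg) auto
    then have base0: "0 \<le> 1 + measure M A * (exp \<theta> - 1)" by (simp add: algebra_simps)
    have "(\<integral>x. exp (\<theta> * D x) \<partial>?\<Omega>) = c * (1 + measure M A * (exp \<theta> - 1)) ^ n"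
      unfolding split by (simp add: expectation_exp_count(2)[OF M A])
    also have "\<dots> \<le> c * exp (measure M A * (\<theta> + \<theta>\<^sup>2)) ^ n"
      using base base0 by (intro mult_left_mono power_mono) (auto simp: c_def)
    also have "\<dots> = exp (real n * measure M A * \<theta>\<^sup>2)"
      by (simp add: c_def exp_of_nat_mult[symmetric] exp_add[symmetric] algebra_simps)
    also have "\<dots> \<le> exp (real n * P * l\<^sup>2)"
    proof -
      have "\<theta>\<^sup>2 = l\<^sup>2" using \<theta> by (metis power2_abs)
      then show ?thesis using P by (simp add: mult_left_mono mult_right_mono)
    qed
    finally have mgf: "(\<integral>x. exp (\<theta> * D x) \<partial>?\<Omega>) \<le> exp (real n * P * l\<^sup>2)" .
    have "measure ?\<Omega> {x \<in> space ?\<Omega>. exp (l * a) \<le> exp (\<theta> * D x)} \<le> (\<integral>x. exp (\<theta> * D x) \<partial>?\<Omega>) / exp (l * a)"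
    proof (rule integral_Markov_inequality_measure[where A = "{}"])
      show "integrable ?\<Omega> (\<lambda>x. exp (\<theta> * D x))"
        unfolding split by (intro integrable_mult_right expectation_exp_count(1) M A)
    qed auto
    also have "\<dots> \<le> exp (real n * P * l\<^sup>2) / exp (l * a)"
      using mgf by (intro divide_right_mono) auto
    also have "\<dots> = exp (real n * P * l\<^sup>2 - l * a)" by (simp add: exp_diff)
    also have "real n * P * l\<^sup>2 - l * a = - a\<^sup>2 / (4 * real n * P)"
      using nP by (simp add: l_def power2_eq_square field_simps)
    finally show ?thesis .
  qed
  have tail_sets: "{x \<in> space ?\<Omega>. exp (l * a) \<le> exp (\<theta> * D x)} \<in> sets ?\<Omega>" for \<theta>
    by measurable
  have "{x \<in> space ?\<Omega>. a < \<bar>D x\<bar>} \<subseteq> {x \<in> space ?\<Omega>. exp (l * a) \<le> exp (l * D x)}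
      \<union> {x \<in> space ?\<Omega>. exp (l * a) \<le> exp ((- l) * D x)}"
  proof
    fix x assume "x \<in> {x \<in> space ?\<Omega>. a < \<bar>D x\<bar>}"
    then have "x \<in> space ?\<Omega>" "a < D x \<or> a < - D x" by auto
    moreover have "l * a \<le> l * D x" if "a < D x" using that l by simp
    moreover have "l * a \<le> l * (- D x)" if "a < - D x" using that l by (intro mult_left_mono) auto
    ultimately show "x \<in> {x \<in> space ?\<Omega>. exp (l * a) \<le> exp (l * D x)}
      \<union> {x \<in> space ?\<Omega>. exp (l * a) \<le> exp ((- l) * D x)}" by auto
  qed
  then have "measure ?\<Omega> {x \<in> space ?\<Omega>. a < \<bar>D x\<bar>} \<le> measure ?\<Omega> ({x \<in> space ?\<Omega>. exp (l * a) \<le> exp (l * D x)}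
      \<union> {x \<in> space ?\<Omega>. exp (l * a) \<le> exp ((- l) * D x)})"
    by (intro \<Omega>.finite_measure_mono sets.Un tail_sets)
  also have "\<dots> \<le> measure ?\<Omega> {x \<in> space ?\<Omega>. exp (l * a) \<le> exp (l * D x)}
      + measure ?\<Omega> {x \<in> space ?\<Omega>. exp (l * a) \<le> exp ((- l) * D x)}"
    by (intro measure_Un_le tail_sets)
  also have "\<dots> \<le> 2 * exp (- a\<^sup>2 / (4 * real n * P))"
    using tail[of l] tail[of "- l"] l by simp
  finally show "measure ?\<Omega> {x \<in> space ?\<Omega>. a < \<bar>D x\<bar>} \<le> 2 * exp (- a\<^sup>2 / (4 * real n * P))" .
qed

lemma unit_square_cbox: "unit_square = cbox (0, 0) (1, 1)"
  by (simp add: unit_square_def cbox_Pair_eq)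

lemma emeasure_unit_square: "emeasure lborel unit_square = 1"
proof -
  have "emeasure lborel unit_square = ennreal (measure lborel unit_square)"
    unfolding unit_square_cbox by (rule emeasure_eq_ennreal_measure) (simp add: emeasure_lborel_cbox_eq)
  then show ?thesis by (simp add: unit_square_cbox content_Pair)
qed

lemma prob_space_uniform_square: "prob_space (uniform_measure lborel unit_square)"
  by (rule prob_space_uniform_measure) (simp_all add: emeasure_unit_square)

lemma box_sets: "{\<alpha>..\<beta>} \<times> {0..h} \<in> sets (borel :: (real \<times> real) measure)" for \<alpha> \<beta> h :: real
  by (intro borel_closed closed_Times closed_atLeastAtMost)

lemma measure_uniform_square_box:
  assumes "0 \<le> \<alpha>" "\<alpha> \<le> \<beta>" "\<beta> \<le> 1" "0 \<le> h" "h \<le> 1"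
  shows "measure (uniform_measure lborel unit_square) ({\<alpha>..\<beta>} \<times> {0..h}) = (\<beta> - \<alpha>) * h"
proof -
  have "measure (uniform_measure lborel unit_square) ({\<alpha>..\<beta>} \<times> {0..h})
      = measure lborel (unit_square \<inter> {\<alpha>..\<beta>} \<times> {0..h}) / measure lborel unit_square"
    by (rule measure_uniform_measure) (simp_all add: emeasure_unit_square box_sets)
  also have "measure lborel unit_square = 1"
    by (simp add: unit_square_cbox content_Pair)
  also have "unit_square \<inter> {\<alpha>..\<beta>} \<times> {0..h} = cbox (\<alpha>, 0) (\<beta>, h)"
    using assms by (auto simp: unit_square_def cbox_Pair_eq)
  finally show ?thesis using assms by (simp add: content_Pair)
qed

text \<open>
  Every box lies between two boxes, the inner one possibly empty, with corners at multiples of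
  \<open>1 / n\<close>. Their areas differ from
  its area by at most \<open>5 / n\<close>, that is by at most \<open>5\<close> expected points. This reduces a continuum of
  boxes to polynomially many.
\<close>

lemma evenly_spread_from_grid:
  fixes n :: nat
  assumes n: "0 < n"
    and grid: "\<And>u v l. u \<le> v \<Longrightarrow> v \<le> n \<Longrightarrow> l \<le> n \<Longrightarrow>
      real v / real n - real u / real n \<le> W + 2 / real n \<Longrightarrow>
      \<bar>real (box_count n p (real u / real n) (real v / real n) (real l / real n))
        - real n * ((real v / real n - real u / real n) * (real l / real n))\<bar> \<le> E"
    and E: "0 \<le> E"
  shows "evenly_spread n p W (E + 5)"
  unfolding evenly_spread_def
proof (intro allI impI)
  fix \<alpha> \<beta> h :: real
  assume H: "0 \<le> \<alpha> \<and> \<alpha> \<le> \<beta> \<and> \<beta> \<le> 1 \<and> 0 \<le> h \<and> h \<le> 1 \<and> \<beta> - \<alpha> \<le> W"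
  define N where "N = real n"
  have N: "1 \<le> N" using n by (simp add: N_def)
  have mono: "real (box_count n p a b g) \<le> real (box_count n p a' b' g')"
    if "a' \<le> a" "b \<le> b'" "g \<le> g'" for a b g a' b' g'
    unfolding box_count_def using that by (intro of_nat_mono card_mono) auto
  have ub: "\<alpha> * N \<le> N" "\<beta> * N \<le> N" "h * N \<le> N"
    using H N by (auto simp: mult_le_cancel_right1)
  have lb: "0 \<le> \<alpha> * N" "0 \<le> \<beta> * N" "0 \<le> h * N" "\<alpha> * N \<le> \<beta> * N"
    using H N by (auto intro: mult_right_mono)
  \<comment> \<open>round the box outwards\<close>
  have upper: "real (box_count n p \<alpha> \<beta> h) \<le> N * (\<beta> - \<alpha>) * h + (E + 5)"
  proof -
    define u v l where "u = nat \<lfloor>\<alpha> * N\<rfloor>" and "v = nat \<lceil>\<beta> * N\<rceil>" and "l = nat \<lceil>h * N\<rceil>"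
    have u: "real u \<le> \<alpha> * N" "\<alpha> * N < real u + 1" using lb by (auto simp: u_def)
    have v: "\<beta> * N \<le> real v" "real v < \<beta> * N + 1" using lb by (auto simp: v_def) linarith+
    have l: "h * N \<le> real l" "real l < h * N + 1" using lb by (auto simp: l_def) linarith+
    have "real u \<le> real v" using u v lb by linarith
    then have uv: "u \<le> v" by simp
    have vn: "v \<le> n" "l \<le> n"
      using ub by (auto simp: v_def l_def N_def nat_le_iff ceiling_le_iff)
    have u': "real u / N \<le> \<alpha>" "\<alpha> \<le> real u / N + 1 / N"
      using u N by (auto simp: field_simps)
    have v': "\<beta> \<le> real v / N" "real v / N \<le> \<beta> + 1 / N"
      using v N by (auto simp: field_simps)
    have l': "h \<le> real l / N" "real l / N \<le> h + 1 / N"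
      using l N by (auto simp: field_simps)
    have width: "real v / N - real u / N \<le> \<beta> - \<alpha> + 2 / N"
      using u' v' by linarith
    note height = l'(2)
    have "(real v / N - real u / N) * (real l / N) \<le> (\<beta> - \<alpha> + 2 / N) * (h + 1 / N)"
      using width height H N by (intro mult_mono) auto
    also have "\<dots> = (\<beta> - \<alpha>) * h + ((\<beta> - \<alpha>) + 2 * h + 2 * (1 / N)) / N"
      using N by (simp add: field_simps)
    also have "\<dots> \<le> (\<beta> - \<alpha>) * h + 5 / N"
    proof -
      have "1 / N \<le> 1" using N by simp
      then show ?thesis using H N by (intro add_left_mono divide_right_mono) linarith+
    qed
    finally have "N * ((real v / N - real u / N) * (real l / N)) \<le> N * ((\<beta> - \<alpha>) * h + 5 / N)"
      using N by (intro mult_left_mono) auto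
    also have "\<dots> = N * (\<beta> - \<alpha>) * h + 5"
      using N by (simp add: algebra_simps)
    finally have "N * ((real v / N - real u / N) * (real l / N)) \<le> N * (\<beta> - \<alpha>) * h + 5" .
    moreover have "real (box_count n p (real u / N) (real v / N) (real l / N))
        \<le> N * ((real v / N - real u / N) * (real l / N)) + E"
    proof -
      have "real v / N - real u / N \<le> W + 2 / N" using width H by linarith
      from grid[OF uv vn this[unfolded N_def]] show ?thesis
        unfolding N_def by linarith
    qed
    moreover have "real (box_count n p \<alpha> \<beta> h) \<le> real (box_count n p (real u / N) (real v / N) (real l / N))"
      by (rule mono[OF u'(1) v'(1) l'(1)])
    ultimately show ?thesis by linarith
  qed
  \<comment> \<open>round the box inwards\<close>
  have lower: "N * (\<beta> - \<alpha>) * h - (E + 5) \<le> real (box_count n p \<alpha> \<beta> h)"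
  proof -
    define u v l where "u = nat \<lceil>\<alpha> * N\<rceil>" and "v = nat \<lfloor>\<beta> * N\<rfloor>" and "l = nat \<lfloor>h * N\<rfloor>"
    have u: "\<alpha> * N \<le> real u" "real u < \<alpha> * N + 1" using lb by (auto simp: u_def) linarith+
    have v: "real v \<le> \<beta> * N" "\<beta> * N < real v + 1" using lb by (auto simp: v_def)
    have l: "real l \<le> h * N" "h * N < real l + 1" using lb by (auto simp: l_def)
    show ?thesis
    proof (cases "u \<le> v")
      case True
      have "real v \<le> real n" "real l \<le> real n" using v l ub by (auto simp: N_def)
      then have vn: "v \<le> n" "l \<le> n" by auto
      have u': "\<alpha> \<le> real u / N" "real u / N \<le> \<alpha> + 1 / N"
        using u N by (auto simp: field_simps)
      have v': "real v / N \<le> \<beta>" "\<beta> \<le> real v / N + 1 / N"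
        using v N by (auto simp: field_simps)
      have height: "real l / N \<le> h" "h \<le> real l / N + 1 / N"
        using l N by (auto simp: field_simps)
      have width: "real v / N - real u / N \<le> \<beta> - \<alpha>" "\<beta> - \<alpha> \<le> (real v / N - real u / N) + 2 / N"
        using u' v' by linarith+
      define w g where "w = real v / N - real u / N" and "g = real l / N"
      have wg: "0 \<le> w" "w \<le> 1" "0 \<le> g" "g \<le> 1"
      proof -
        show "0 \<le> w" using True N by (simp add: w_def divide_right_mono)
        show "0 \<le> g" using N by (simp add: g_def)
        show "w \<le> 1" using width(1) H unfolding w_def by linarith
        show "g \<le> 1" using height(1) H unfolding g_def by linarith
      qed
      have "(\<beta> - \<alpha>) * h \<le> (w + 2 / N) * (g + 1 / N)"
        using width height H wg N by (intro mult_mono) (auto simp: w_def g_def)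
      also have "\<dots> = w * g + (w + 2 * g + 2 * (1 / N)) / N"
        using N by (simp add: field_simps)
      also have "\<dots> \<le> w * g + 5 / N"
      proof -
        have "1 / N \<le> 1" using N by simp
        then show ?thesis using wg N by (intro add_left_mono divide_right_mono) linarith+
      qed
      finally have "N * ((\<beta> - \<alpha>) * h) \<le> N * (w * g + 5 / N)"
        using N by (intro mult_left_mono) auto
      also have "\<dots> = N * (w * g) + 5"
        using N by (simp add: algebra_simps)
      finally have "N * (\<beta> - \<alpha>) * h \<le> N * (w * g) + 5"
        by (simp add: mult.assoc)
      moreover have "N * (w * g) \<le> real (box_count n p (real u / N) (real v / N) (real l / N)) + E"
      proof -
        have "0 \<le> 2 / N" using N by simp
        then have "real v / N - real u / N \<le> W + 2 / N" using width(1) H by linarith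
        from grid[OF True vn this[unfolded N_def]] show ?thesis
          unfolding N_def w_def g_def by linarith
      qed
      moreover have "real (box_count n p (real u / N) (real v / N) (real l / N)) \<le> real (box_count n p \<alpha> \<beta> h)"
        by (rule mono[OF u'(1) v'(1) height(1)])
      ultimately show ?thesis by linarith
    next
      case False
      then have "real v + 1 \<le> real u" by linarith
      then have "(\<beta> - \<alpha>) * N \<le> 1 + 0" using u v by (simp add: algebra_simps)
      then have "N * (\<beta> - \<alpha>) * h \<le> 1 * 1"
        using H N by (intro mult_mono) (auto simp: mult.commute)
      then show ?thesis using E by linarith
    qed
  qed
  show "\<bar>real (box_count n p \<alpha> \<beta> h) - real n * (\<beta> - \<alpha>) * h\<bar> \<le> E + 5"
    using upper lower unfolding N_def by linarith
qed

lemma evenly_spread_whp: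
  fixes n :: nat and W E :: real
  assumes n: "0 < n" and E: "0 < E" "E \<le> 2 * real n * (W + 2 / real n)"
  shows "\<exists>B \<in> sets (uniform_points n).
    measure (uniform_points n) B \<le> 2 * (real n + 1) ^ 3 * exp (- E\<^sup>2 / (4 * real n * (W + 2 / real n))) \<and>
    (\<forall>x \<in> space (uniform_points n) - B. evenly_spread n x W (E + 5))"
proof -
  define \<Omega> where "\<Omega> = uniform_points n"
  define P where "P = W + 2 / real n"
  define I where "I = {(u, v, l). u \<le> v \<and> v \<le> n \<and> l \<le> n \<and> real v / real n - real u / real n \<le> P}"
  define F where "F = (\<lambda>(u, v, l). {x \<in> space \<Omega>.
    E < \<bar>real (box_count n x (real u / real n) (real v / real n) (real l / real n))
        - real n * ((real v / real n - real u / real n) * (real l / real n))\<bar>})"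
  have I_sub: "I \<subseteq> {..n} \<times> {..n} \<times> {..n}" unfolding I_def by auto
  then have finI: "finite I" by (rule finite_subset) auto
  have "card I \<le> card ({..n} \<times> {..n} \<times> {..n})" using I_sub by (intro card_mono) auto
  then have "real (card I) \<le> real ((n + 1) * ((n + 1) * (n + 1)))"
    by (intro of_nat_mono) (simp add: card_cartesian_product)
  then have cardI: "real (card I) \<le> (real n + 1) ^ 3"
    by (simp add: power3_eq_cube algebra_simps)
  have F: "F k \<in> sets \<Omega> \<and> measure \<Omega> (F k) \<le> 2 * exp (- E\<^sup>2 / (4 * real n * P))" if k: "k \<in> I" for k
  proof -
    obtain u v l where uvl: "k = (u, v, l)" "u \<le> v" "v \<le> n" "l \<le> n" "real v / real n - real u / real n \<le> P"
      using k unfolding I_def by auto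
    let ?\<alpha> = "real u / real n" and ?\<beta> = "real v / real n" and ?h = "real l / real n"
    have bounds: "0 \<le> ?\<alpha>" "?\<alpha> \<le> ?\<beta>" "?\<beta> \<le> 1" "0 \<le> ?h" "?h \<le> 1"
      using uvl n by (auto simp: divide_right_mono)
    note meas = measure_uniform_square_box[OF bounds]
    have "(?\<beta> - ?\<alpha>) * ?h \<le> (?\<beta> - ?\<alpha>) * 1" using bounds by (intro mult_left_mono) auto
    then have le: "measure (uniform_measure lborel unit_square) ({?\<alpha>..?\<beta>} \<times> {0..?h}) \<le> P"
      using uvl(5) meas by simp
    have "{?\<alpha>..?\<beta>} \<times> {0..?h} \<in> sets (uniform_measure lborel unit_square)"
      by (simp add: box_sets)
    note tail = chernoff_count[OF prob_space_uniform_square this le E(1) E(2)[folded P_def]]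
    show ?thesis
      using tail[unfolded meas]
      by (simp only: F_def uvl(1) prod.case \<Omega>_def uniform_points_def box_count_def simp_thms)
  qed
  have "measure \<Omega> (\<Union>(F ` I)) \<le> (\<Sum>k\<in>I. measure \<Omega> (F k))"
    using F by (intro measure_UNION_le finI) auto
  also have "\<dots> \<le> (\<Sum>k\<in>I. 2 * exp (- E\<^sup>2 / (4 * real n * P)))"
    using F by (intro sum_mono) auto
  also have "\<dots> = real (card I) * (2 * exp (- E\<^sup>2 / (4 * real n * P)))" by simp
  also have "\<dots> \<le> (real n + 1) ^ 3 * (2 * exp (- E\<^sup>2 / (4 * real n * P)))"
    using cardI by (intro mult_right_mono) auto
  finally have "measure \<Omega> (\<Union>(F ` I)) \<le> 2 * (real n + 1) ^ 3 * exp (- E\<^sup>2 / (4 * real n * P))"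
    by simp
  moreover have "\<Union>(F ` I) \<in> sets \<Omega>" using F finI by (intro sets.finite_UN) auto
  moreover have "evenly_spread n x W (E + 5)" if "x \<in> space \<Omega> - \<Union>(F ` I)" for x
  proof (rule evenly_spread_from_grid[OF n])
    fix u v l :: nat
    assume "u \<le> v" "v \<le> n" "l \<le> n" "real v / real n - real u / real n \<le> W + 2 / real n"
    then have "(u, v, l) \<in> I" by (simp add: I_def P_def)
    then have "x \<notin> F (u, v, l)" using that by blast
    then show "\<bar>real (box_count n x (real u / real n) (real v / real n) (real l / real n))
        - real n * ((real v / real n - real u / real n) * (real l / real n))\<bar> \<le> E"
      using that by (simp add: F_def not_less)
  qed (use E in simp)
  ultimately show ?thesis unfolding \<Omega>_def P_def by blast
qed

section \<open>Optimal colourings of random geometric graphs\<close>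

lemma orthogonally_colourable_cong:
  assumes "\<And>u v. u \<in> V \<Longrightarrow> v \<in> V \<Longrightarrow> adj u v \<longleftrightarrow> adj' u v"
  shows "orthogonally_colourable V adj k \<longleftrightarrow> orthogonally_colourable V adj' k"
  using assms unfolding orthogonally_colourable_def proper_colouring_def by simp

text \<open>
  The event depends on the sample only through the adjacency pattern on \<open>{..<n}\<close>, of which there
  are finitely many.
\<close>

lemma sets_optimal:
  "{x \<in> space (uniform_points n). has_optimal_orthogonal_colouring {..<n} (geometric_adj r x)}
    \<in> sets (uniform_points n)"
proof -
  let ?\<Omega> = "uniform_points n"
  define S where "S F = {x \<in> space ?\<Omega>. \<forall>i\<in>{..<n}. \<forall>j\<in>{..<n}. geometric_adj r x i j \<longleftrightarrow> (i, j) \<in> F}" for F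
  have optimal_cong: "has_optimal_orthogonal_colouring {..<n} (geometric_adj r x)
      \<longleftrightarrow> has_optimal_orthogonal_colouring {..<n} (\<lambda>i j. (i, j) \<in> F)" if "x \<in> S F" for x F
    using orthogonally_colourable_cong[of "{..<n}" "geometric_adj r x" "\<lambda>i j. (i, j) \<in> F"] that
    by (simp add: S_def has_optimal_orthogonal_colouring_def orthogonal_chromatic_number_def)
  have S_sets: "S F \<in> sets ?\<Omega>" for F
  proof -
    have coord: "(\<lambda>x. x i) \<in> borel_measurable ?\<Omega>" if "i < n" for i
    proof -
      have "(\<lambda>x. x i) \<in> measurable ?\<Omega> (uniform_measure lborel unit_square)"
        unfolding uniform_points_def using that by (intro measurable_component_singleton) auto
      then show ?thesis by (simp cong: measurable_cong_sets)
    qed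
    have edge: "{x \<in> space ?\<Omega>. geometric_adj r x i j \<longleftrightarrow> (i, j) \<in> F} \<in> sets ?\<Omega>" if "i < n" "j < n" for i j
    proof -
      note [measurable] = coord[OF that(1)] coord[OF that(2)]
      show ?thesis unfolding geometric_adj_def by measurable
    qed
    show ?thesis unfolding S_def
      by (intro sets.sets_Collect_finite_All) (auto intro: edge)
  qed
  have "{x \<in> space ?\<Omega>. has_optimal_orthogonal_colouring {..<n} (geometric_adj r x)}
    = (\<Union>F \<in> {F \<in> Pow ({..<n} \<times> {..<n}). has_optimal_orthogonal_colouring {..<n} (\<lambda>i j. (i, j) \<in> F)}. S F)"
    (is "?L = ?R")
  proof
    show "?R \<subseteq> ?L" using optimal_cong by (auto simp: S_def)
    show "?L \<subseteq> ?R"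
    proof
      fix x assume x: "x \<in> ?L"
      define F where "F = {(i, j). i < n \<and> j < n \<and> geometric_adj r x i j}"
      have "x \<in> S F" using x by (auto simp: S_def F_def)
      moreover have "F \<in> Pow ({..<n} \<times> {..<n})" by (auto simp: F_def)
      ultimately show "x \<in> ?R" using optimal_cong x by blast
    qed
  qed
  also have "\<dots> \<in> sets ?\<Omega>"
    by (rule sets.finite_UN) (auto intro: S_sets finite_subset[of _ "Pow ({..<n} \<times> {..<n})"])
  finally show ?thesis .
qed

lemma RG_prob_optimal_ge:
  fixes n N s :: nat and r W E1 E D :: real
  assumes n: "n = N\<^sup>2"
    and s: "0 < s" "s \<le> N"
    and E1: "0 < E1" "E1 \<le> 2 * real n * (1 + 2 / real n)"
    and E: "0 < E" "E \<le> 2 * real n * (W + 2 / real n)"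
    and W: "2 * real s / real N + 2 * (E1 + 5) / real n \<le> W"
    and D1: "2 * real s / real N + (E1 + 5) / real n \<le> D"
    and D2: "1 / real N + 4 * (E + 5) / (real s * real N) \<le> D"
    and r: "r + 2 * D \<le> (sqrt (real N) - 2) / real N"
  shows "1 - (2 * (real n + 1) ^ 3 * exp (- E1\<^sup>2 / (4 * real n * (1 + 2 / real n)))
      + 2 * (real n + 1) ^ 3 * exp (- E\<^sup>2 / (4 * real n * (W + 2 / real n))))
    \<le> RG_prob n r has_optimal_orthogonal_colouring"
    (is "1 - (?T1 + ?T2) \<le> _")
proof -
  let ?\<Omega> = "uniform_points n"
  let ?S = "{x \<in> space ?\<Omega>. has_optimal_orthogonal_colouring {..<n} (geometric_adj r x)}"
  have npos: "0 < n" using n s by simp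
  interpret \<Omega>: prob_space ?\<Omega>
    unfolding uniform_points_def by (intro prob_space_PiM prob_space_uniform_square)
  from evenly_spread_whp[OF npos E1] obtain B1 where B1: "B1 \<in> sets ?\<Omega>" "measure ?\<Omega> B1 \<le> ?T1"
      "\<And>x. x \<in> space ?\<Omega> - B1 \<Longrightarrow> evenly_spread n x 1 (E1 + 5)"
    by blast
  from evenly_spread_whp[OF npos E] obtain B2 where B2: "B2 \<in> sets ?\<Omega>" "measure ?\<Omega> B2 \<le> ?T2"
      "\<And>x. x \<in> space ?\<Omega> - B2 \<Longrightarrow> evenly_spread n x W (E + 5)"
    by blast
  have "AE y in uniform_measure lborel unit_square. y \<in> unit_square"
    by (intro AE_uniform_measureI) (auto simp: unit_square_cbox)
  then have "AE x in ?\<Omega>. x i \<in> unit_square" if "i < n" for i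
    unfolding uniform_points_def using that
    by (intro AE_PiM_component[where I = "{..<n}" and M = "\<lambda>_. uniform_measure lborel unit_square"]
        prob_space_uniform_square) auto
  then have "AE x in ?\<Omega>. \<forall>i\<in>{..<n}. x i \<in> unit_square"
    by (intro AE_finite_allI) auto
  then have "AE x in ?\<Omega>. x \<in> space ?\<Omega> - (B1 \<union> B2) \<longrightarrow> x \<in> ?S"
  proof (rule AE_mp, intro AE_I2 impI)
    fix x assume x: "\<forall>i\<in>{..<n}. x i \<in> unit_square" "x \<in> space ?\<Omega> - (B1 \<union> B2)"
    have "has_optimal_orthogonal_colouring {..<n} (geometric_adj r x)"
    proof (rule optimal_if_evenly_spread[OF n _ B1(3) B2(3) s W D1 D2 r])
      show "x i \<in> unit_square" if "i < n" for i using x(1) that by simp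
    qed (use x(2) in auto)
    then show "x \<in> ?S" using x(2) by simp
  qed
  then have "measure ?\<Omega> (space ?\<Omega> - (B1 \<union> B2)) \<le> measure ?\<Omega> ?S"
    by (rule \<Omega>.finite_measure_mono_AE[OF _ sets_optimal])
  moreover have "measure ?\<Omega> (space ?\<Omega> - (B1 \<union> B2)) = 1 - measure ?\<Omega> (B1 \<union> B2)"
    by (rule \<Omega>.prob_compl[OF sets.Un[OF B1(1) B2(1)]])
  moreover have "measure ?\<Omega> (B1 \<union> B2) \<le> measure ?\<Omega> B1 + measure ?\<Omega> B2"
    by (rule measure_Un_le[OF B1(1) B2(1)])
  ultimately show ?thesis
    unfolding RG_prob_def using B1(2) B2(2) by linarith
qed

text \<open>
  With \<open>n = N\<^sup>2\<close> and strips of about \<open>n powr (1/5)\<close> columns, strips have width of order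
  \<open>W = n powr (-3/10)\<close>, which is of smaller order than \<open>n powr (-1/4)\<close>. An error \<open>E = n powr (2/5)\<close> within a
  strip of about \<open>n powr (7/10)\<close> points displaces them by the same order, and so does an error
  \<open>E1 = n powr (7/10)\<close> in the ranking of all \<open>n\<close> points. The Chernoff exponents are then of order
  \<open>E\<^sup>2 / (n W) = n powr (1/10)\<close> and \<open>E1\<^sup>2 / n = n powr (2/5)\<close>, large enough to beat the
  \<open>(n + 1) ^ 3\<close> boxes. The factors \<open>8\<close> and \<open>7\<close> dominate the sums of the leading coefficients.
\<close>

lemma RG_optimal_orthogonal_colouring_on_squares:
  fixes c :: real and r :: "nat \<Rightarrow> real"
  assumes "c < 1" and r: "\<And>n. n \<ge> 1 \<Longrightarrow> r n \<le> c * real n powr (- 1 / 4)"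
  shows "((\<lambda>n. RG_prob n (r n) has_optimal_orthogonal_colouring) \<longlongrightarrow> 1)
           (inf sequentially (principal {n. \<exists>N. n = N\<^sup>2}))"
proof -
  define W where "W n = 8 * real n powr (- 3 / 10)" for n
  define E1 where "E1 n = real n powr (7 / 10)" for n
  define E where "E n = real n powr (2 / 5)" for n
  define D where "D n = 7 * real n powr (- 3 / 10)" for n
  define T where "T n = 2 * (real n + 1) ^ 3 * exp (- (E1 n)\<^sup>2 / (4 * real n * (1 + 2 / real n)))
      + 2 * (real n + 1) ^ 3 * exp (- (E n)\<^sup>2 / (4 * real n * (W n + 2 / real n)))" for n :: nat
  have T: "T \<longlonglongrightarrow> 0"
    unfolding T_def E1_def E_def W_def by real_asymp
  have ev: "\<forall>\<^sub>F n in sequentially. 1 \<le> n \<and>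
      E1 n \<le> 2 * real n * (1 + 2 / real n) \<and>
      E n \<le> 2 * real n * (W n + 2 / real n) \<and>
      real n powr (1 / 5) + 1 \<le> real n powr (1 / 2) \<and>
      2 * (real n powr (1 / 5) + 1) / real n powr (1 / 2) + 2 * (E1 n + 5) / real n \<le> W n \<and>
      2 * (real n powr (1 / 5) + 1) / real n powr (1 / 2) + (E1 n + 5) / real n \<le> D n \<and>
      1 / real n powr (1 / 2) + 4 * (E n + 5) / (real n powr (1 / 5) * real n powr (1 / 2)) \<le> D n \<and>
      c * real n powr (- 1 / 4) + 2 * D n \<le> (real n powr (1 / 4) - 2) / real n powr (1 / 2)"
    unfolding E1_def E_def W_def D_def using \<open>c < 1\<close>
    by (intro eventually_conj; real_asymp)
  have lower: "1 - T n \<le> RG_prob n (r n) has_optimal_orthogonal_colouring"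
    if n: "n = N\<^sup>2" and H: "1 \<le> n \<and>
      E1 n \<le> 2 * real n * (1 + 2 / real n) \<and>
      E n \<le> 2 * real n * (W n + 2 / real n) \<and>
      real n powr (1 / 5) + 1 \<le> real n powr (1 / 2) \<and>
      2 * (real n powr (1 / 5) + 1) / real n powr (1 / 2) + 2 * (E1 n + 5) / real n \<le> W n \<and>
      2 * (real n powr (1 / 5) + 1) / real n powr (1 / 2) + (E1 n + 5) / real n \<le> D n \<and>
      1 / real n powr (1 / 2) + 4 * (E n + 5) / (real n powr (1 / 5) * real n powr (1 / 2)) \<le> D n \<and>
      c * real n powr (- 1 / 4) + 2 * D n \<le> (real n powr (1 / 4) - 2) / real n powr (1 / 2)"
    for n N
  proof -
    have npos: "0 < real n" using H by simp
    then have N: "0 < real N" using n by (cases "N = 0") auto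
    have powN: "real n powr (1 / 2) = real N"
      using N by (simp add: n powr_half_sqrt)
    have "real n powr (1 / 4) = (real n powr (1 / 2)) powr (1 / 2)"
      by (simp add: powr_powr)
    then have pow4: "real n powr (1 / 4) = sqrt (real N)"
      using N by (simp add: powN powr_half_sqrt)
    define s where "s = nat \<lceil>real n powr (1 / 5)\<rceil>"
    have pos5: "0 < real n powr (1 / 5)" using npos by simp
    have s: "real n powr (1 / 5) \<le> real s" "real s \<le> real n powr (1 / 5) + 1"
      using pos5 unfolding s_def by linarith+
    have "0 < real s" using s pos5 by linarith
    then have s0: "0 < s" by simp
    have "real s \<le> real N" using s(2) H powN by linarith
    then have sN: "s \<le> N" by simp
    have sq: "2 * real s / real N \<le> 2 * (real n powr (1 / 5) + 1) / real N"
      using s(2) N by (intro divide_right_mono) auto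
    have Epos: "0 < E1 n" "0 < E n" using npos by (auto simp: E1_def E_def)
    have "4 * (E n + 5) / (real s * real N) \<le> 4 * (E n + 5) / (real n powr (1 / 5) * real N)"
    proof (rule divide_left_mono)
      show "real n powr (1 / 5) * real N \<le> real s * real N"
        using s(1) N by (intro mult_right_mono) auto
      show "0 < real s * real N * (real n powr (1 / 5) * real N)"
        using s0 pos5 N by simp
    qed (use Epos in simp)
    then have D2: "1 / real N + 4 * (E n + 5) / (real s * real N) \<le> D n"
      using H unfolding powN by linarith
    have "r n \<le> c * real n powr (- 1 / 4)" using r H by blast
    then have rn: "r n + 2 * D n \<le> (sqrt (real N) - 2) / real N"
      using H unfolding powN pow4 by linarith
    show ?thesis
      unfolding T_def
    proof (rule RG_prob_optimal_ge[OF n s0 sN Epos(1) _ Epos(2) _ _ _ D2 rn])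
      show "2 * real s / real N + 2 * (E1 n + 5) / real n \<le> W n"
        using H sq unfolding powN by linarith
      show "2 * real s / real N + (E1 n + 5) / real n \<le> D n"
        using H sq unfolding powN by linarith
    qed (use H in blast)+
  qed
  show ?thesis
  proof (rule tendsto_sandwich)
    show "\<forall>\<^sub>F n in inf sequentially (principal {n. \<exists>N. n = N\<^sup>2}).
        1 - T n \<le> RG_prob n (r n) has_optimal_orthogonal_colouring"
      unfolding eventually_inf_principal using ev
      by eventually_elim (use lower in blast)
    show "\<forall>\<^sub>F n in inf sequentially (principal {n. \<exists>N. n = N\<^sup>2}).
        RG_prob n (r n) has_optimal_orthogonal_colouring \<le> 1"
    proof (rule always_eventually, rule allI)
      fix n
      have "prob_space (uniform_points n)"
        unfolding uniform_points_def by (intro prob_space_PiM prob_space_uniform_square)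
      then show "RG_prob n (r n) has_optimal_orthogonal_colouring \<le> 1"
        unfolding RG_prob_def by (rule prob_space.prob_le_1)
    qed
    have "(\<lambda>n. 1 - T n) \<longlonglongrightarrow> 1 - 0"
      by (intro tendsto_diff tendsto_const T)
    then show "((\<lambda>n. 1 - T n) \<longlongrightarrow> 1) (inf sequentially (principal {n. \<exists>N. n = N\<^sup>2}))"
      by (intro tendsto_mono[OF inf_le1]) simp
  qed (rule tendsto_const)
qed

theorem theorem3p11:
  fixes c :: real and r :: "nat \<Rightarrow> real" and m t :: "nat \<Rightarrow> nat"
  assumes "0 < c" and "c < 1"
    and "\<And>n. n \<ge> 1 \<Longrightarrow> r n \<le> c * real n powr (- 1 / 4)"
  shows "((\<lambda>n. RG_prob n (r n) has_optimal_orthogonal_colouring) \<longlongrightarrow> 1)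
           (inf sequentially (principal (admissible_sizes r m t)))"
proof (rule tendsto_mono[OF _ RG_optimal_orthogonal_colouring_on_squares[OF assms(2,3)]])
  have "admissible_sizes r m t \<subseteq> {n. \<exists>N. n = N\<^sup>2}"
    unfolding admissible_sizes_def by (auto intro: exI[of _ "m _ * t _"] simp: power_mult_distrib)
  then show "inf sequentially (principal (admissible_sizes r m t))
      \<le> inf sequentially (principal {n. \<exists>N. n = N\<^sup>2})"
    by (intro inf_mono) auto
qed

end
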